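(* Let $\omega$ be partitioned as an edge patch of one of the three types (d), (e), (f) described in the context. Then there exists a constant $\beta>0$, independent of the shape (aspect ratio) and size of the elements in the partition $\mathscr{P}$, such that $$\inf_{0\neq q\in M_{\mathscr{P}}(\omega)}\ \sup_{\boldsymbol{0}\neq\boldsymbol{v}\in \boldsymbol{V}_{\mathscr{P}}(\omega)}\ \frac{\int_\omega q\,\operatorname{div}\boldsymbol{v}\,\mathrm{d}\boldsymbol{x}}{|\boldsymbol{v}|_{1,\omega}\,\|q\|_{0,\omega}}\ \ge\ \beta .$$ (The constant $\beta$ depends only on the fixed shape-regularity bound $\sigma$ of the macro elements introduced in the context.)
   Context: **Spaces.** For a polygonal set $\omega$ with a conforming partition $\mathscr{P}$ into closed axis-parallel rectangles, $\mathbb{Q}_\ell(K)$ is the space of polynomials on $K$ of degree at most $\ell$ in each variable. $M_{\mathscr{P}}(\omega)$ is the space of functions $q$ continuous on $\omega$, belonging to $\mathbb{Q}_1(K)$ on each cell $K\in\mathscr{P}$, with $\int_\omega q=0$. $\boldsymbol{V}_{\mathscr{P}}(\omega)$ is the space of continuous vector fields $\boldsymbol{v}:\omega\to\mathbb{R}^2$ with $\boldsymbol{v}|_K\in\mathbb{Q}_2(K)^2$ for each $K\in\mathscr{P}$ and $\boldsymbol{v}=\boldsymbol{0}$ on $\partial\omega$. $\|\cdot\|_{0,\omega}$ is the $L^2(\omega)$ norm and $|\boldsymbol{v}|_{1,\omega}=\|\nabla\boldsymbol{v}\|_{0,\omega}$. **Edge patches** (up to a rigid motion mapping coordinate directions to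 coordinate directions). Macro elements are shape regular; $\sigma\ge1$ is a fixed bound for this. In all three types every "long and thin" element of the coarse patch is divided into two "long and thin" elements by a division orthogonal to its long side. Types (d) and (e): $\omega=M\cup M'$ with flat part $M=[-H,H]\times[-h,h]$ and shape-regular part $M'=[-H,H]\times[h,h+L]$, where $0<h\le H$ and $\sigma^{-1}H\le L\le\sigma H$. $M'$ is divided into two cells by the line $x=0$. In type (d), $M$ is divided into two cells by the line $x=0$; in type (e), $M$ is divided into four cells by the lines $x=0$ and $y=0$. Type (f) ("overlapped" edge patch): $\omega$ is the image of the L-shaped set $[0,1]^2\setminus[0,t)^2$ under a map $(x,y)\mapsto(A_1x,A_2y)$ with $A_1/A_2\in[\sigma^{-1},\sigma]$. Before mapping, the coarse patch consists of the two long and thin parts $[t,1]\times[0,t]$ and $[0,t]\times[t,1]$ and the shape-regular part $[t,1]^2$, where $0<t\le\frac12$ (so that the short side of a thin part does not exceed its long side). The partition is obtained by dividing along the lines $x=(1+t)/2$ and $y=(1+t)/2$, so that each long and thin part is bisected at the midpoints of its long sides and $[t,1]^2$ is divided into four cells. *)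

theory Defs
  imports "HOL-Analysis.Analysis"
begin

type_synonym point = "real \<times> real"

definition Q_space :: "nat \<Rightarrow> point set \<Rightarrow> (point \<Rightarrow> real) set" where
  "Q_space l K =
     {q. \<exists>c. \<forall>(x, y)\<in>K. q (x, y) = (\<Sum>i\<le>l. \<Sum>j\<le>l. c i j * x ^ i * y ^ j)}"

text \<open>
  Functions on \<open>\<omega>\<close> are represented by total functions whose values outside \<open>\<omega>\<close> are irrelevant;
  accordingly, being nonzero always means being nonzero somewhere on \<open>\<omega>\<close>.
\<close>

definition pressure_space :: "point set \<Rightarrow> point set set \<Rightarrow> (point \<Rightarrow> real) set" where
  "pressure_space \<omega> P =
     {q. continuous_on \<omega> q \<and> (\<forall>K\<in>P. q \<in> Q_space 1 K) \<and> (LINT x:\<omega>|lebesgue. q x) = 0}"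

definition velocity_space :: "point set \<Rightarrow> point set set \<Rightarrow> (point \<Rightarrow> point) set" where
  "velocity_space \<omega> P =
     {v. continuous_on \<omega> v
       \<and> (\<forall>K\<in>P. fst \<circ> v \<in> Q_space 2 K \<and> snd \<circ> v \<in> Q_space 2 K)
       \<and> (\<forall>x\<in>frontier \<omega>. v x = 0)}"

text \<open>
  Derivatives are classical ones. A velocity is a polynomial in the interior of each cell, so only
  the cell boundaries are exceptional: there the value of \<open>frechet_derivative\<close> may be arbitrary,
  and may depend on values of the field outside \<open>\<omega>\<close>. This is a null set, and integrating with
  respect to \<open>lebesgue\<close>, which is complete, makes it irrelevant also for measurability. For the
  continuous piecewise polynomial fields considered here the result is the weak derivative.
\<close>

definition divergence :: "(point \<Rightarrow> point) \<Rightarrow> point \<Rightarrow> real" where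
  "divergence v x = (\<Sum>b\<in>Basis. frechet_derivative v (at x) b \<bullet> b)"

definition L2_norm_on :: "point set \<Rightarrow> (point \<Rightarrow> real) \<Rightarrow> real" where
  "L2_norm_on \<omega> q = sqrt (LINT x:\<omega>|lebesgue. (q x)\<^sup>2)"

definition H1_seminorm_on :: "point set \<Rightarrow> (point \<Rightarrow> point) \<Rightarrow> real" where
  "H1_seminorm_on \<omega> v =
     sqrt (LINT x:\<omega>|lebesgue. (\<Sum>b\<in>Basis. (norm (frechet_derivative v (at x) b))\<^sup>2))"

definition inf_sup :: "point set \<Rightarrow> point set set \<Rightarrow> ereal" where
  "inf_sup \<omega> P =
     (INF q \<in> {q \<in> pressure_space \<omega> P. \<exists>x\<in>\<omega>. q x \<noteq> 0}.
      SUP v \<in> {v \<in> velocity_space \<omega> P. \<exists>x\<in>\<omega>. v x \<noteq> 0}.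
        ereal ((LINT x:\<omega>|lebesgue. q x * divergence v x)
               / (H1_seminorm_on \<omega> v * L2_norm_on \<omega> q)))"

definition patch_d :: "real \<Rightarrow> point set \<Rightarrow> point set set \<Rightarrow> bool" where
  "patch_d \<sigma> \<omega> P \<longleftrightarrow>
     (\<exists>H h L. 0 < h \<and> h \<le> H \<and> inverse \<sigma> * H \<le> L \<and> L \<le> \<sigma> * H
       \<and> \<omega> = {-H..H} \<times> {-h..h} \<union> {-H..H} \<times> {h..h+L}
       \<and> P = {{-H..0} \<times> {-h..h}, {0..H} \<times> {-h..h},
              {-H..0} \<times> {h..h+L}, {0..H} \<times> {h..h+L}})"

definition patch_e :: "real \<Rightarrow> point set \<Rightarrow> point set set \<Rightarrow> bool" where
  "patch_e \<sigma> \<omega> P \<longleftrightarrow>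
     (\<exists>H h L. 0 < h \<and> h \<le> H \<and> inverse \<sigma> * H \<le> L \<and> L \<le> \<sigma> * H
       \<and> \<omega> = {-H..H} \<times> {-h..h} \<union> {-H..H} \<times> {h..h+L}
       \<and> P = {{-H..0} \<times> {-h..0}, {0..H} \<times> {-h..0},
              {-H..0} \<times> {0..h}, {0..H} \<times> {0..h},
              {-H..0} \<times> {h..h+L}, {0..H} \<times> {h..h+L}})"

definition patch_f :: "real \<Rightarrow> point set \<Rightarrow> point set set \<Rightarrow> bool" where
  "patch_f \<sigma> \<omega> P \<longleftrightarrow>
     (\<exists>A\<^sub>1 A\<^sub>2 t. 0 < A\<^sub>1 \<and> 0 < A\<^sub>2 \<and> inverse \<sigma> \<le> A\<^sub>1 / A\<^sub>2 \<and> A\<^sub>1 / A\<^sub>2 \<le> \<sigma> \<and> 0 < t \<and> t \<le> 1 / 2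
       \<and> (let S = (\<lambda>(x, y). (A\<^sub>1 * x, A\<^sub>2 * y)); m = (1 + t) / 2 in
            \<omega> = S ` ({0..1} \<times> {0..1} - {0..<t} \<times> {0..<t})
          \<and> P = (`) S ` {{t..m} \<times> {0..t}, {m..1} \<times> {0..t},
                         {0..t} \<times> {t..m}, {0..t} \<times> {m..1},
                         {t..m} \<times> {t..m}, {m..1} \<times> {t..m},
                         {t..m} \<times> {m..1}, {m..1} \<times> {m..1}}))"

definition coordinate_rigid_motion :: "(point \<Rightarrow> point) \<Rightarrow> bool" where
  "coordinate_rigid_motion T \<longleftrightarrow>
     (\<exists>f c. orthogonal_transformation f \<and> f ` Basis \<subseteq> Basis \<union> uminus ` Basis
        \<and> T = (\<lambda>x. c + f x))"

definition edge_patch :: "real \<Rightarrow> point set \<Rightarrow> point set set \<Rightarrow> bool" where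
  "edge_patch \<sigma> \<omega> P \<longleftrightarrow>
     (\<exists>T \<omega>\<^sub>0 P\<^sub>0. coordinate_rigid_motion T
        \<and> (patch_d \<sigma> \<omega>\<^sub>0 P\<^sub>0 \<or> patch_e \<sigma> \<omega>\<^sub>0 P\<^sub>0 \<or> patch_f \<sigma> \<omega>\<^sub>0 P\<^sub>0)
        \<and> \<omega> = T ` \<omega>\<^sub>0 \<and> P = (`) T ` P\<^sub>0)"

end

theory Submission
  imports Defs
begin

text \<open>
  The pressure is continuous, so on a cell its variation is visible in the differences between
  neighbouring vertices, and one test velocity per row of two cells, supported on that row, is enough
  to see the differences across the row. Let \<open>u\<close> point along the row and \<open>w\<close> across it. On each of the
  two cells \<open>\<partial>\<^sub>w q\<close> is affine in the \<open>u\<close>-coordinate \<open>x\<close> and constant in the \<open>w\<close>-coordinate \<open>y\<close>, so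
  \<open>v = - hat(x) y (1 - y) \<partial>\<^sub>w q(x) w\<close> is continuous, piecewise biquadratic and
  zero on the boundary of the row, where \<open>hat\<close> is the piecewise affine function with value 1
  on the interface of the two cells and 0 at the two ends.
  Integration by parts turns the pairing into \<open>\<integral> hat(x) y (1 - y) (\<partial>\<^sub>w q)\<^sup>2\<close>, which controls the
  difference of \<open>q\<close> along all three edges in direction \<open>w\<close> (\<open>strip_estimate\<close>). The Dirichlet energy of \<open>v\<close>
  is of the same order as the pairing, with a constant that depends only on an upper bound for
  \<open>|w| / |u|\<close>. A long thin row fits: only its height has to be small compared with its length, so the
  aspect ratio does not enter. On a single cell the field with \<open>x (1 - x)\<close> times a constant in place of
  \<open>hat(x) \<partial>\<^sub>w q(x)\<close> controls the mean of the two differences in direction \<open>w\<close> (\<open>cell_estimate\<close>).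

  These differences suffice. In the shape regular part they link all vertices to one reference vertex;
  in types (d) and (e), where it consists of a single row, the differences along the row come from the cell
  bubbles. Every vertex of a thin part is linked by an edge across the thin part, or two such edges in
  type (e), to a vertex of the shape regular part. Moving a bound from a shape regular cell to a
  thin cell costs nothing, since the area of the thin cell is at most a multiple of the other area. Hence
  the area of each cell times the squared deviation of \<open>q\<close> from its value at the reference vertex is
  bounded at all corners (\<open>norm_bound_d\<close>, \<open>norm_bound_e\<close>, \<open>norm_bound_f\<close>), and, because \<open>q\<close> has mean zero,
  this bounds \<open>\<parallel>q\<parallel>\<^sup>2\<close>.

  The argument runs by contradiction: if no velocity gives a quotient above \<open>\<beta>\<close>, then
  all these differences are at most a multiple of \<open>\<beta> \<parallel>q\<parallel>\<close>, and \<open>\<parallel>q\<parallel>\<^sup>2 \<le> N \<beta>\<^sup>2 \<parallel>q\<parallel>\<^sup>2\<close>, where \<open>N\<close> depends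
  only on \<open>\<sigma>\<close>. In this form each test velocity is used alone, and their supports may overlap.
\<close>

section \<open>Axis-parallel charts\<close>

text \<open>
  Cells are described as images of the unit square under affine maps with axis-parallel edge vectors
  of arbitrary length, sign and order. All rigid motions of a patch, the stretching in type (f) and the
  choice between rows and columns become choices of such a map, so that every integral is computed on
  the unit square.
\<close>

definition axes :: "point \<Rightarrow> point \<Rightarrow> bool" where
  "axes u w \<longleftrightarrow> u \<noteq> 0 \<and> w \<noteq> 0 \<and> (snd u = 0 \<and> fst w = 0 \<or> fst u = 0 \<and> snd w = 0)"

definition chart :: "point \<Rightarrow> point \<Rightarrow> point \<Rightarrow> point \<Rightarrow> point" where
  "chart c u w z = c + fst z *\<^sub>R u + snd z *\<^sub>R w"

definition coord :: "point \<Rightarrow> point \<Rightarrow> point \<Rightarrow> real" where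
  "coord c u z = ((z - c) \<bullet> u) / (u \<bullet> u)"

definition tile :: "point \<Rightarrow> point \<Rightarrow> point \<Rightarrow> point set" where
  "tile c u w = chart c u w ` cbox (0, 0) (1, 1)"

lemma axes_commute: "axes u w \<Longrightarrow> axes w u"
  by (auto simp: axes_def)

lemma axes_scale: "axes u w \<Longrightarrow> r \<noteq> 0 \<Longrightarrow> s \<noteq> 0 \<Longrightarrow> axes (r *\<^sub>R u) (s *\<^sub>R w)"
  by (auto simp: axes_def)

lemma axes_uminus: "axes u w \<Longrightarrow> axes (- u) w"
  by (auto simp: axes_def)

lemma axes_cases:
  assumes "axes u w"
  obtains (straight) a d where "a \<noteq> 0" "d \<noteq> 0" "u = (a, 0)" "w = (0, d)"
    | (swapped) a d where "a \<noteq> 0" "d \<noteq> 0" "u = (0, a)" "w = (d, 0)"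
  using assms by (cases u; cases w) (auto simp: axes_def zero_prod_def)

lemma coord_chart: "axes u w \<Longrightarrow> coord c u (chart c u w z) = fst z \<and> coord c w (chart c u w z) = snd z"
  by (erule axes_cases) (auto simp: coord_def chart_def inner_prod_def)

lemma chart_coord: "axes u w \<Longrightarrow> chart c u w (coord c u z, coord c w z) = z"
  by (erule axes_cases; cases z; cases c) (auto simp: coord_def chart_def inner_prod_def)

lemma inj_chart: "axes u w \<Longrightarrow> inj (chart c u w)"
  by (metis coord_chart injI prod_eqI)

lemma mem_tile: "axes u w \<Longrightarrow> z \<in> tile c u w \<longleftrightarrow> coord c u z \<in> {0..1} \<and> coord c w z \<in> {0..1}"
proof -
  assume a: "axes u w"
  have "z \<in> tile c u w \<longleftrightarrow> (coord c u z, coord c w z) \<in> cbox (0,0) (1,1)"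
    unfolding tile_def using chart_coord[OF a, of c z] coord_chart[OF a, of c]
    by (metis (no_types, lifting) image_iff prod.collapse)
  then show ?thesis by (simp add: cbox_Pair_eq)
qed

lemma affine_image_interval:
  fixes s m :: real
  assumes "s \<noteq> 0"
  obtains p' q' where "(\<lambda>x. m + s * x) ` {p..q} = {p'..q'}"
    "measure lborel {p'..q'} = \<bar>s\<bar> * measure lborel {p..q}"
proof (cases "p \<le> q")
  case True
  show ?thesis
  proof (rule that)
    show "(\<lambda>x. m + s * x) ` {p..q} = {m + min (s*p) (s*q) .. m + max (s*p) (s*q)}"
      using image_affinity_atLeastAtMost[of s m p q] assms True
      by (auto simp: add.commute min_def max_def)
    show "measure lborel {m + min (s*p) (s*q) .. m + max (s*p) (s*q)} = \<bar>s\<bar> * measure lborel {p..q}"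
      using True assms mult_left_mono[of p q s] mult_left_mono_neg[of p q s]
      by (cases "s > 0") (auto simp: min_def max_def algebra_simps)
  qed
next
  case False
  then show ?thesis using that[of 1 0] by auto
qed

lemma chart_cbox:
  assumes "axes u w"
  obtains p q where "chart c u w ` cbox a b = cbox p q"
    "measure lborel (cbox p q) = norm u * norm w * measure lborel (cbox a b)"
proof -
  obtain a1 a2 b1 b2 c1 c2 where [simp]: "a = (a1,a2)" "b = (b1,b2)" "c = (c1,c2)"
    by (cases a, cases b, cases c)
  show ?thesis using assms
  proof (cases rule: axes_cases)
    case (straight s r)
    obtain p1 q1 where 1: "(\<lambda>x. c1 + s * x) ` {a1..b1} = {p1..q1}" "measure lborel {p1..q1} = \<bar>s\<bar> * measure lborel {a1..b1}"
      using affine_image_interval[of s c1 a1 b1] straight by blast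
    obtain p2 q2 where 2: "(\<lambda>x. c2 + r * x) ` {a2..b2} = {p2..q2}" "measure lborel {p2..q2} = \<bar>r\<bar> * measure lborel {a2..b2}"
      using affine_image_interval[of r c2 a2 b2] straight by blast
    have "chart c u w ` cbox a b = (\<lambda>x. c1 + s * x) ` {a1..b1} \<times> (\<lambda>x. c2 + r * x) ` {a2..b2}"
      by (force simp: chart_def straight cbox_Pair_eq image_iff mult.commute)
    also have "\<dots> = cbox (p1,p2) (q1,q2)" by (simp add: 1 2 cbox_Pair_eq)
    finally show ?thesis
      by (rule that) (use 1 2 straight in \<open>simp add: content_Pair\<close>)
  next
    case (swapped s r)
    obtain p1 q1 where 1: "(\<lambda>x. c1 + r * x) ` {a2..b2} = {p1..q1}" "measure lborel {p1..q1} = \<bar>r\<bar> * measure lborel {a2..b2}"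
      using affine_image_interval[of r c1 a2 b2] swapped by blast
    obtain p2 q2 where 2: "(\<lambda>x. c2 + s * x) ` {a1..b1} = {p2..q2}" "measure lborel {p2..q2} = \<bar>s\<bar> * measure lborel {a1..b1}"
      using affine_image_interval[of s c2 a1 b1] swapped by blast
    have "chart c u w ` cbox a b = (\<lambda>x. c1 + r * x) ` {a2..b2} \<times> (\<lambda>x. c2 + s * x) ` {a1..b1}"
      by (force simp: chart_def swapped cbox_Pair_eq image_iff mult.commute)
    also have "\<dots> = cbox (p1,p2) (q1,q2)" by (simp add: 1 2 cbox_Pair_eq)
    finally show ?thesis
      by (rule that) (use 1 2 swapped in \<open>simp add: content_Pair\<close>)
  qed
qed

lemma chart_inverse:
  assumes "axes u w"
  obtains c' u' w' where "axes u' w'" "\<And>z. chart c' u' w' z = (coord c u z, coord c w z)"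
    "norm u' * norm w' = 1 / (norm u * norm w)"
  using assms
proof (cases rule: axes_cases)
  case (straight s r)
  show ?thesis
    by (rule that[of "(1/s, 0)" "(0, 1/r)" "(- fst c / s, - snd c / r)"])
      (use straight in \<open>auto simp: axes_def chart_def coord_def inner_prod_def field_simps zero_prod_def\<close>)
next
  case (swapped s r)
  show ?thesis
    by (rule that[of "(0, 1/r)" "(1/s, 0)" "(- snd c / s, - fst c / r)"])
      (use swapped in \<open>auto simp: axes_def chart_def coord_def inner_prod_def field_simps zero_prod_def\<close>)
qed

text \<open>
  The Jacobian of the chart is \<open>|u| |w|\<close> because its two edge vectors are orthogonal.
\<close>

lemma has_integral_chart:
  fixes f :: "point \<Rightarrow> real"
  assumes a: "axes u w" and f: "((\<lambda>z. f (chart c u w z)) has_integral i) (cbox p q)"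
  shows "(f has_integral (norm u * norm w * i)) (chart c u w ` cbox p q)"
proof -
  obtain c' u' w' where a': "axes u' w'" and g: "\<And>z. chart c' u' w' z = (coord c u z, coord c w z)"
    and n: "norm u' * norm w' = 1 / (norm u * norm w)"
    using chart_inverse[OF a] by metis
  have pos: "norm u * norm w > 0" using a by (simp add: axes_def)
  have hg: "chart c u w (chart c' u' w' z) = z" for z by (simp add: g chart_coord[OF a])
  have gh: "chart c' u' w' (chart c u w z) = z" for z by (simp add: g coord_chart[OF a])
  have "((\<lambda>z. f (chart c u w (chart c' u' w' z))) has_integral (1 / (1 / (norm u * norm w))) *\<^sub>R i)
    (chart c u w ` cbox p q)"
  proof (rule has_integral_twiddle[where f = "\<lambda>z. f (chart c u w z)"])
    show "0 < 1 / (norm u * norm w)" using pos by simp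
    show "continuous (at x) (chart c' u' w')" for x
      unfolding chart_def by (intro continuous_intros)
    show "\<exists>w z. chart c' u' w' ` cbox x y = cbox w z" for x y
      using chart_cbox[OF a'] by metis
    show "\<exists>w' z. chart c u w ` cbox x y = cbox w' z" for x y
      using chart_cbox[OF a] by metis
    show "measure lborel (chart c' u' w' ` cbox x y) = 1 / (norm u * norm w) * measure lborel (cbox x y)" for x y
      using chart_cbox[OF a', of c' x y] n by metis
  qed (use hg gh f in auto)
  then show ?thesis by (simp add: hg)
qed

lemma tile_cbox:
  assumes "axes u w"
  obtains p q where "tile c u w = cbox p q" "box p q \<noteq> {}"
proof -
  obtain p q where pq: "tile c u w = cbox p q"
    "measure lborel (cbox p q) = norm u * norm w * measure lborel (cbox (0::real,0::real) (1,1))"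
    unfolding tile_def using chart_cbox[OF assms] by metis
  have "measure lborel (cbox p q) > 0"
    using assms by (simp add: pq content_Pair axes_def)
  then have "box p q \<noteq> {}" by (simp add: content_pos_lt_eq box_ne_empty)
  with pq that show ?thesis by blast
qed

section \<open>Cellwise integration\<close>

definition tiling :: "point set \<Rightarrow> point set set \<Rightarrow> bool" where
  "tiling \<omega> P \<longleftrightarrow> finite P \<and> \<omega> = \<Union>P \<and> (\<forall>K\<in>P. \<exists>c u w. axes u w \<and> K = tile c u w)
     \<and> pairwise (\<lambda>K K'. negligible (K \<inter> K')) P"

lemma tiling_cbox:
  assumes "tiling \<omega> P" "K \<in> P"
  obtains p q where "K = cbox p q" "box p q \<noteq> {}"
  using assms tile_cbox unfolding tiling_def by metis

text \<open>
  The null set on which a piecewise polynomial field need not be differentiable.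
\<close>

definition skeleton :: "point set set \<Rightarrow> point set" where
  "skeleton P = (\<Union>K\<in>P. frontier K)"

lemma negligible_skeleton: "tiling \<omega> P \<Longrightarrow> negligible (skeleton P)"
  unfolding skeleton_def
  by (rule negligible_Union)
    (auto simp: tiling_def elim!: tiling_cbox intro!: negligible_convex_frontier, metis convex_box(1) tile_cbox)

lemma interior_off_skeleton:
  assumes "tiling \<omega> P" "K \<in> P" "z \<in> K - skeleton P"
  shows "z \<in> interior K"
proof -
  have "closed K" using tiling_cbox[OF assms(1,2)] closed_cbox by metis
  then show ?thesis using assms by (auto simp: skeleton_def frontier_def)
qed

lemma tiling_subset: "tiling \<omega> P \<Longrightarrow> K \<in> P \<Longrightarrow> K \<subseteq> \<omega>"
  by (auto simp: tiling_def)

text \<open>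
  Absolute integrability is part of the conclusion, since the Lebesgue integral over \<open>\<omega>\<close> is zero
  by convention when it fails.
\<close>

lemma cellwise_integral:
  fixes g :: "point \<Rightarrow> real"
  assumes t: "tiling \<omega> P"
    and g: "\<And>K z. K \<in> P \<Longrightarrow> z \<in> K - skeleton P \<Longrightarrow> g z = G K z"
    and G: "\<And>K. K \<in> P \<Longrightarrow> continuous_on K (G K)"
  shows "set_integrable lebesgue \<omega> g"
    and "(LINT z:\<omega>|lebesgue. g z) = (\<Sum>K\<in>P. integral K (G K))"
proof -
  have K: "g absolutely_integrable_on K \<and> (g has_integral integral K (G K)) K" if "K \<in> P" for K
  proof -
    obtain p q where K: "K = cbox p q" using tiling_cbox[OF t \<open>K \<in> P\<close>] by metis
    have "G K absolutely_integrable_on K"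
      using G[OF that] unfolding K by (rule absolutely_integrable_continuous)
    then have 1: "g absolutely_integrable_on K"
      by (rule absolutely_integrable_spike[OF _ negligible_skeleton[OF t]]) (use g that in auto)
    have "(G K has_integral integral K (G K)) K"
      using G[OF that] unfolding K by (simp add: integrable_continuous integrable_integral)
    then have "(g has_integral integral K (G K)) K"
      by (rule has_integral_spike[OF negligible_skeleton[OF t], rotated]) (use g that in auto)
    with 1 show ?thesis by simp
  qed
  have fin: "finite P" and om: "\<omega> = (\<Union>K\<in>P. K)" and pw: "pairwise (\<lambda>K K'. negligible (K \<inter> K')) P"
    using t by (auto simp: tiling_def)
  show int: "set_integrable lebesgue \<omega> g"
    unfolding om
  proof (rule set_integrable_UN[OF fin])
    show "i \<in> sets lebesgue" if "i \<in> P" for i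
      using tiling_cbox[OF t that] by (metis lmeasurable_cbox fmeasurableD)
  qed (use K in auto)
  have "(g has_integral (\<Sum>K\<in>P. integral K (G K))) (\<Union>P)"
    by (rule has_integral_Union[OF fin _ pw]) (use K in auto)
  then show "(LINT z:\<omega>|lebesgue. g z) = (\<Sum>K\<in>P. integral K (G K))"
    using set_lebesgue_integral_eq_integral(2)[OF int] om by (simp add: integral_unique)
qed

lemma frechet_derivative_interior:
  assumes "z \<in> interior K" "\<And>x. x \<in> K \<Longrightarrow> v x = V x" "(V has_derivative D) (at z)"
  shows "frechet_derivative v (at z) = D"
proof -
  have "(v has_derivative D) (at z)"
    using assms(3) open_interior assms(1)
    by (rule has_derivative_transform_within_open) (use assms(2) interior_subset in force)
  then show ?thesis using frechet_derivative_at by metis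
qed

text \<open>
  Off the skeleton the derivative of \<open>v\<close> is that of the smooth extension \<open>V K\<close> of its restriction to the
  cell, so the bilinear form and the energy are sums of integrals of polynomials.
\<close>

lemma cellwise_forms:
  assumes t: "tiling \<omega> P"
    and v: "\<And>K z. K \<in> P \<Longrightarrow> z \<in> K \<Longrightarrow> v z = V K z"
    and D: "\<And>K z. K \<in> P \<Longrightarrow> (V K has_derivative D K z) (at z)"
    and contD: "\<And>K b. K \<in> P \<Longrightarrow> b \<in> Basis \<Longrightarrow> continuous_on K (\<lambda>z. D K z b)"
    and q: "continuous_on \<omega> q"
  shows "(LINT z:\<omega>|lebesgue. q z * divergence v z)
      = (\<Sum>K\<in>P. integral K (\<lambda>z. q z * (\<Sum>b\<in>Basis. D K z b \<bullet> b)))"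
    and "set_integrable lebesgue \<omega> (\<lambda>z. \<Sum>b\<in>Basis. (norm (frechet_derivative v (at z) b))\<^sup>2)"
    and "(LINT z:\<omega>|lebesgue. \<Sum>b\<in>Basis. (norm (frechet_derivative v (at z) b))\<^sup>2)
      = (\<Sum>K\<in>P. integral K (\<lambda>z. \<Sum>b\<in>Basis. (norm (D K z b))\<^sup>2))"
proof -
  have fd: "frechet_derivative v (at z) = D K z" if "K \<in> P" "z \<in> K - skeleton P" for K z
    using interior_off_skeleton[OF t that] v[OF that(1)] D[OF that(1)]
    by (rule frechet_derivative_interior)
  have qK: "continuous_on K q" if "K \<in> P" for K
    using continuous_on_subset[OF q] tiling_subset[OF t that] by blast
  show "(LINT z:\<omega>|lebesgue. q z * divergence v z)
      = (\<Sum>K\<in>P. integral K (\<lambda>z. q z * (\<Sum>b\<in>Basis. D K z b \<bullet> b)))"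
    by (rule cellwise_integral(2)[OF t])
      (auto simp: divergence_def fd intro!: continuous_intros contD qK)
  show "set_integrable lebesgue \<omega> (\<lambda>z. \<Sum>b\<in>Basis. (norm (frechet_derivative v (at z) b))\<^sup>2)"
    by (rule cellwise_integral(1)[OF t, where G = "\<lambda>K z. \<Sum>b\<in>Basis. (norm (D K z b))\<^sup>2"])
      (auto simp: fd intro!: continuous_intros contD)
  show "(LINT z:\<omega>|lebesgue. \<Sum>b\<in>Basis. (norm (frechet_derivative v (at z) b))\<^sup>2)
      = (\<Sum>K\<in>P. integral K (\<lambda>z. \<Sum>b\<in>Basis. (norm (D K z b))\<^sup>2))"
    by (rule cellwise_integral(2)[OF t])
      (auto simp: fd intro!: continuous_intros contD)
qed

text \<open>
  This lemma and the next deal with the two degenerate cases in which the quotient says nothing about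
  the pairing: a field outside the range of the supremum and a quotient with zero denominator.
\<close>

lemma pairing_zero_if_field_zero:
  assumes "tiling \<omega> P" "continuous_on \<omega> q" "\<And>z. z \<in> \<omega> \<Longrightarrow> v z = 0"
  shows "(LINT z:\<omega>|lebesgue. q z * divergence v z) = 0"
proof -
  have "(LINT z:\<omega>|lebesgue. q z * divergence v z)
      = (\<Sum>K\<in>P. integral K (\<lambda>z. q z * (\<Sum>b\<in>Basis. (0::point) \<bullet> b)))"
    by (rule cellwise_forms(1)[OF assms(1), where V = "\<lambda>_ _. 0" and D = "\<lambda>_ _ _. 0"])
      (use assms(2,3) tiling_subset[OF assms(1)] in auto)
  then show ?thesis by simp
qed

lemma pairing_zero_if_seminorm_zero:
  assumes int: "set_integrable lebesgue \<omega> (\<lambda>z. \<Sum>b\<in>Basis. (norm (frechet_derivative v (at z) b))\<^sup>2)"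
    and z: "H1_seminorm_on \<omega> v = 0"
  shows "(LINT z:\<omega>|lebesgue. q z * divergence v z) = 0"
proof -
  let ?g = "\<lambda>z. \<Sum>b\<in>Basis. (norm (frechet_derivative v (at z) b))\<^sup>2"
  have "integral\<^sup>L lebesgue (\<lambda>z. indicat_real \<omega> z *\<^sub>R ?g z) = 0"
    using z by (simp add: H1_seminorm_on_def set_lebesgue_integral_def)
  moreover have "AE z in lebesgue. 0 \<le> indicat_real \<omega> z *\<^sub>R ?g z"
    by (intro AE_I2) (auto intro!: mult_nonneg_nonneg sum_nonneg)
  ultimately have "AE z in lebesgue. indicat_real \<omega> z *\<^sub>R ?g z = 0"
    using int integral_nonneg_eq_0_iff_AE unfolding set_integrable_def by blast
  then have "AE z in lebesgue. indicat_real \<omega> z *\<^sub>R (q z * divergence v z) = 0"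
  proof (rule AE_mp, intro AE_I2 impI)
    fix z assume "indicat_real \<omega> z *\<^sub>R ?g z = 0"
    then have "z \<notin> \<omega> \<or> ?g z = 0" by (auto simp: indicator_def)
    moreover have "divergence v z = 0" if "?g z = 0"
      using that by (simp add: sum_nonneg_eq_0_iff divergence_def)
    ultimately show "indicat_real \<omega> z *\<^sub>R (q z * divergence v z) = 0" by auto
  qed
  then show ?thesis unfolding set_lebesgue_integral_def by (rule integral_eq_zero_AE)
qed

text \<open>
  A cell is the closure of its interior. If it met the open set \<open>U\<close>, its interior would meet \<open>U\<close> in a
  nonempty open set, which would be covered by the negligible intersections with cells of \<open>A\<close>.
\<close>

lemma disjoint_from_other_cells:
  assumes t: "tiling \<omega> P" and A: "A \<subseteq> P" and K: "K \<in> P" "K \<notin> A"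
    and U: "open U" "U \<subseteq> \<Union>A"
  shows "K \<inter> U = {}"
proof (rule ccontr)
  assume "K \<inter> U \<noteq> {}"
  obtain p q where pq: "K = cbox p q" "box p q \<noteq> {}" using tiling_cbox[OF t K(1)] .
  have "closure (box p q) \<inter> U \<noteq> {}"
    using \<open>K \<inter> U \<noteq> {}\<close> pq by (simp add: closure_box)
  then have ne: "box p q \<inter> U \<noteq> {}" using U(1) by (simp add: Int_commute open_Int_closure_eq_empty)
  have "negligible (\<Union>L\<in>A. K \<inter> L)"
  proof (rule negligible_Union)
    show "finite ((\<inter>) K ` A)" using A t finite_subset by (auto simp: tiling_def)
    show "negligible s" if "s \<in> (\<inter>) K ` A" for s
    proof -
      obtain L where L: "L \<in> A" "s = K \<inter> L" using \<open>s \<in> (\<inter>) K ` A\<close> by blast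
      then have "L \<in> P" "K \<noteq> L" using A K by auto
      then show ?thesis using t K(1) unfolding tiling_def pairwise_def L(2) by blast
    qed
  qed
  then have "negligible (box p q \<inter> U)"
    by (rule negligible_subset) (use U(2) pq box_subset_cbox in fastforce)
  then show False using open_not_negligible ne U(1) by (metis open_Int open_box)
qed

section \<open>Test velocities\<close>

text \<open>
  On the unit square, \<open>e0 * (1 - s) + e1 * s\<close> is the affine function with end values \<open>e0\<close> and \<open>e1\<close>; in the
  application these are edge differences of the pressure. The further factor \<open>1 - s\<close> is the hat
  function of the row, restricted to one of its two cells. For \<open>e0 = 0\<close> the ramp is a multiple of the bubble.
\<close>

definition ramp :: "real \<Rightarrow> real \<Rightarrow> real \<Rightarrow> real" where
  "ramp e0 e1 s = (1 - s) * (e0 * (1 - s) + e1 * s)"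

definition bubble :: "real \<Rightarrow> real" where
  "bubble t = t * (1 - t)"

definition ramp' :: "real \<Rightarrow> real \<Rightarrow> real \<Rightarrow> real" where
  "ramp' e0 e1 s = (1 - 2 * s) * e1 - 2 * (1 - s) * e0"

definition cell_field :: "point \<Rightarrow> point \<Rightarrow> point \<Rightarrow> real \<Rightarrow> real \<Rightarrow> point \<Rightarrow> point" where
  "cell_field c u w e0 e1 z = - (ramp e0 e1 (coord c u z) * bubble (coord c w z)) *\<^sub>R w"

definition cell_deriv :: "point \<Rightarrow> point \<Rightarrow> point \<Rightarrow> real \<Rightarrow> real \<Rightarrow> point \<Rightarrow> point \<Rightarrow> point" where
  "cell_deriv c u w e0 e1 z h =
     - (ramp' e0 e1 (coord c u z) * ((h \<bullet> u) / (u \<bullet> u)) * bubble (coord c w z)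
        + ramp e0 e1 (coord c u z) * ((1 - 2 * coord c w z) * ((h \<bullet> w) / (w \<bullet> w)))) *\<^sub>R w"

lemma coord_has_derivative: "(coord c u has_derivative (\<lambda>h. (h \<bullet> u) / (u \<bullet> u))) (at z)"
  unfolding coord_def divide_inverse by (auto intro!: derivative_eq_intros)

lemma continuous_on_coord [continuous_intros]: "continuous_on S (coord c u)"
  unfolding coord_def divide_inverse by (intro continuous_intros)

lemma ramp_has_derivative: "(ramp e0 e1 has_real_derivative ramp' e0 e1 s) (at s)"
  unfolding ramp_def ramp'_def by (auto intro!: derivative_eq_intros simp: algebra_simps)

lemma bubble_has_derivative: "(bubble has_real_derivative (1 - 2 * t)) (at t)"
  unfolding bubble_def by (auto intro!: derivative_eq_intros simp: algebra_simps)

lemma cell_field_has_derivative: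
  "(cell_field c u w e0 e1 has_derivative cell_deriv c u w e0 e1 z) (at z)"
proof -
  have 1: "((\<lambda>z. ramp e0 e1 (coord c u z)) has_derivative
      (\<lambda>h. ((h \<bullet> u) / (u \<bullet> u)) * ramp' e0 e1 (coord c u z))) (at z)"
    using DERIV_compose_FDERIV[OF ramp_has_derivative coord_has_derivative] .
  have 2: "((\<lambda>z. bubble (coord c w z)) has_derivative
      (\<lambda>h. ((h \<bullet> w) / (w \<bullet> w)) * (1 - 2 * coord c w z))) (at z)"
    using DERIV_compose_FDERIV[OF bubble_has_derivative coord_has_derivative] .
  have "((\<lambda>z. - (ramp e0 e1 (coord c u z) * bubble (coord c w z)) *\<^sub>R w) has_derivative
     (\<lambda>h. - (ramp e0 e1 (coord c u z) * (((h \<bullet> w) / (w \<bullet> w)) * (1 - 2 * coord c w z))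
        + ((h \<bullet> u) / (u \<bullet> u)) * ramp' e0 e1 (coord c u z) * bubble (coord c w z)) *\<^sub>R w)) (at z)"
    by (intro has_derivative_scaleR_left has_derivative_minus has_derivative_mult 1 2)
  then show ?thesis
    unfolding cell_field_def[abs_def] cell_deriv_def[abs_def]
    by (rule has_derivative_eq_rhs) (auto simp: algebra_simps)
qed

lemma Basis_point: "(Basis :: point set) = {(1, 0), (0, 1)}"
  by (auto simp: Basis_prod_def)

lemma cell_divergence:
  assumes "axes u w"
  shows "(\<Sum>b\<in>Basis. cell_deriv c u w e0 e1 z b \<bullet> b)
    = - (ramp e0 e1 (coord c u z) * (1 - 2 * coord c w z))"
  using assms
  by (cases rule: axes_cases) (auto simp: Basis_point cell_deriv_def inner_prod_def field_simps power2_eq_square)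

text \<open>
  Only the first summand, which holds the derivative along the row, carries a geometric factor; it is
  harmless whenever the row is not much higher than it is long.
\<close>

lemma cell_gradient:
  assumes "axes u w"
  shows "(\<Sum>b\<in>Basis. (norm (cell_deriv c u w e0 e1 z b))\<^sup>2)
    = (norm w / norm u)\<^sup>2 * (ramp' e0 e1 (coord c u z) * bubble (coord c w z))\<^sup>2
      + (ramp e0 e1 (coord c u z) * (1 - 2 * coord c w z))\<^sup>2"
  using assms
  by (cases rule: axes_cases)
    (auto simp: Basis_point cell_deriv_def inner_prod_def power_mult_distrib power_divide power2_eq_square field_simps)

lemma continuous_on_cell_deriv: "continuous_on S (\<lambda>z. cell_deriv c u w e0 e1 z b)"
  unfolding cell_deriv_def ramp_def ramp'_def bubble_def by (intro continuous_intros)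

definition clamp01 :: "real \<Rightarrow> real" where
  "clamp01 x = max 0 (min x 1)"

text \<open>
  The field on the row \<open>tile c (- u) w \<union> tile c u w\<close>. Clamping the coordinates makes it a globally
  continuous function. The term \<open>- e0\<close> corrects for the half row that does not contain the point, where
  the clamped ramp has the value \<open>e0\<close>.
\<close>

definition strip_field :: "point \<Rightarrow> point \<Rightarrow> point \<Rightarrow> real \<Rightarrow> real \<Rightarrow> real \<Rightarrow> point \<Rightarrow> point" where
  "strip_field c u w e0 e1 e2 z =
     - ((ramp e0 e1 (clamp01 (coord c u z)) + ramp e0 e2 (clamp01 (- coord c u z)) - e0)
        * bubble (clamp01 (coord c w z))) *\<^sub>R w"

lemma coord_uminus: "coord c (- u) z = - coord c u z"
  by (simp add: coord_def)

lemma continuous_strip_field: "continuous_on S (strip_field c u w e0 e1 e2)"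
  unfolding strip_field_def ramp_def bubble_def clamp01_def by (intro continuous_intros)

lemma strip_field_right:
  assumes "axes u w" "z \<in> tile c u w"
  shows "strip_field c u w e0 e1 e2 z = cell_field c u w e0 e1 z"
  using assms by (simp add: mem_tile strip_field_def cell_field_def clamp01_def ramp_def min_def)

lemma strip_field_left:
  assumes "axes u w" "z \<in> tile c (- u) w"
  shows "strip_field c u w e0 e1 e2 z = cell_field c (- u) w e0 e2 z"
  using assms mem_tile[OF axes_uminus[OF assms(1)]]
  by (simp add: strip_field_def cell_field_def clamp01_def ramp_def min_def coord_uminus)

text \<open>
  If \<open>e0 = e2 = 0\<close>, then the field is the bubble of the right cell and the left half of the row need not
  consist of a cell.
\<close>

lemma strip_field_support:
  assumes "axes u w" "strip_field c u w e0 e1 e2 z \<noteq> 0"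
  shows "z \<in> tile c u w \<or> (e0 \<noteq> 0 \<or> e2 \<noteq> 0) \<and> z \<in> tile c (- u) w"
proof -
  have y: "coord c w z \<in> {0..1}"
  proof (rule ccontr)
    assume "coord c w z \<notin> {0..1}"
    then have "bubble (clamp01 (coord c w z)) = 0" by (auto simp: bubble_def clamp01_def)
    then show False using assms(2) by (simp add: strip_field_def)
  qed
  consider "coord c u z > 1" | "coord c u z < -1" | "coord c u z \<in> {0..1}" | "coord c u z \<in> {-1..<0}"
    by fastforce
  then show ?thesis
  proof cases
    case 1
    then show ?thesis using assms(2) by (simp add: strip_field_def ramp_def clamp01_def)
  next
    case 2
    then show ?thesis using assms(2) by (simp add: strip_field_def ramp_def clamp01_def)
  next
    case 3
    then show ?thesis using y assms(1) by (simp add: mem_tile)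
  next
    case 4
    then have "z \<in> tile c (- u) w" using y axes_uminus[OF assms(1)] by (simp add: mem_tile coord_uminus)
    moreover have "e0 \<noteq> 0 \<or> e2 \<noteq> 0"
      using assms(2) 4 by (auto simp: strip_field_def ramp_def clamp01_def)
    ultimately show ?thesis by simp
  qed
qed

lemma product_in_Q_space:
  assumes "\<And>x. A x = (\<Sum>i\<le>l. a i * x ^ i)" "\<And>y. B y = (\<Sum>j\<le>l. b j * y ^ j)"
  shows "(\<lambda>z. A (fst z) * B (snd z)) \<in> Q_space l K"
proof -
  have "A x * B y = (\<Sum>i\<le>l. \<Sum>j\<le>l. (a i * b j) * x ^ i * y ^ j)" for x y
    unfolding assms sum_product by (intro sum.cong refl) (simp add: algebra_simps)
  then show ?thesis unfolding Q_space_def by (auto intro!: exI[of _ "\<lambda>i j. a i * b j"])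
qed

lemma affine_product_quadratic:
  "\<exists>a. \<forall>x::real. (p + q * x) * (r + s * x) = (\<Sum>i\<le>2. a i * x ^ i)"
  by (rule exI[of _ "\<lambda>i::nat. if i = 0 then p * r else if i = 1 then p * s + q * r else q * s"])
    (simp add: numeral_2_eq_2 algebra_simps)

lemma ramp_quadratic: "\<exists>a. \<forall>x. k * ramp e0 e1 ((x - m) / s) = (\<Sum>i\<le>2. a i * x ^ i)"
proof -
  obtain a where a: "\<forall>x::real. (k * (1 + m / s) + (- k / s) * x) * ((e0 + (e0 - e1) * m / s) + ((e1 - e0) / s) * x)
      = (\<Sum>i\<le>2. a i * x ^ i)"
    using affine_product_quadratic[of "k * (1 + m / s)" "- k / s" "e0 + (e0 - e1) * m / s" "(e1 - e0) / s"] by blast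
  have "k * ramp e0 e1 ((x - m) / s)
      = (k * (1 + m / s) + (- k / s) * x) * ((e0 + (e0 - e1) * m / s) + ((e1 - e0) / s) * x)" for x
    unfolding ramp_def by (cases "s = 0") (auto simp: field_simps)
  then show ?thesis using a by auto
qed

lemma bubble_quadratic: "\<exists>a. \<forall>x. k * bubble ((x - m) / s) = (\<Sum>i\<le>2. a i * x ^ i)"
  using ramp_quadratic[of k 0 1 m s] by (simp add: ramp_def bubble_def mult.commute)

lemma cell_field_in_Q_space:
  assumes "axes u w"
  shows "fst \<circ> cell_field c u w e0 e1 \<in> Q_space 2 K \<and> snd \<circ> cell_field c u w e0 e1 \<in> Q_space 2 K"
proof -
  have z: "(\<lambda>_. 0) \<in> Q_space 2 K" by (auto simp: Q_space_def intro!: exI[of _ "\<lambda>_ _. 0"])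
  show ?thesis using assms
  proof (cases rule: axes_cases)
    case (straight s r)
    obtain a where a: "\<And>x. (- r) * ramp e0 e1 ((x - fst c) / s) = (\<Sum>i\<le>2. a i * x ^ i)"
      using ramp_quadratic by metis
    obtain b where b: "\<And>x. 1 * bubble ((x - snd c) / r) = (\<Sum>i\<le>2. b i * x ^ i)"
      using bubble_quadratic by metis
    have "fst \<circ> cell_field c u w e0 e1 = (\<lambda>_. 0)"
      "snd \<circ> cell_field c u w e0 e1 = (\<lambda>z. (- r) * ramp e0 e1 ((fst z - fst c) / s) * (1 * bubble ((snd z - snd c) / r)))"
      using straight by (auto simp: fun_eq_iff cell_field_def coord_def inner_prod_def)
    then show ?thesis using z product_in_Q_space[OF a b] by simp
  next
    case (swapped s r)
    obtain a where a: "\<And>x. 1 * ramp e0 e1 ((x - snd c) / s) = (\<Sum>i\<le>2. a i * x ^ i)"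
      using ramp_quadratic by metis
    obtain b where b: "\<And>x. (- r) * bubble ((x - fst c) / r) = (\<Sum>i\<le>2. b i * x ^ i)"
      using bubble_quadratic by metis
    have "snd \<circ> cell_field c u w e0 e1 = (\<lambda>_. 0)"
      "fst \<circ> cell_field c u w e0 e1 = (\<lambda>z. (- r) * bubble ((fst z - fst c) / r) * (1 * ramp e0 e1 ((snd z - snd c) / s)))"
      using swapped by (auto simp: fun_eq_iff cell_field_def coord_def inner_prod_def)
    then show ?thesis using z product_in_Q_space[OF b a] by simp
  qed
qed

section \<open>Cell integrals\<close>

text \<open>
  The integral of \<open>(1 - s) * (e0 * (1 - s) + e1 * s) * (d0 * (1 - s) + d1 * s)\<close> over the unit interval.
\<close>

definition cell_form :: "real \<Rightarrow> real \<Rightarrow> real \<Rightarrow> real \<Rightarrow> real" where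
  "cell_form e0 e1 d0 d1 = e0 * d0 / 4 + (e0 * d1 + e1 * d0) / 12 + e1 * d1 / 12"

lemma bilinear_on_tile:
  assumes ax: "axes u w" and q: "q \<in> Q_space 1 (tile c u w)" and xy: "x \<in> {0..1}" "y \<in> {0..1}"
  shows "q (chart c u w (x, y))
    = (1 - y) * ((1 - x) * q c + x * q (c + u)) + y * ((1 - x) * q (c + w) + x * q (c + u + w))"
proof -
  obtain k where k: "\<And>x y. (x, y) \<in> tile c u w \<Longrightarrow> q (x, y) = (\<Sum>i\<le>1. \<Sum>j\<le>1. k i j * x ^ i * y ^ j)"
    using q by (fastforce simp: Q_space_def)
  have k': "q z = k 0 0 + k 0 1 * snd z + k 1 0 * fst z + k 1 1 * fst z * snd z" if "z \<in> tile c u w" for z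
    using k[of "fst z" "snd z"] that by simp
  have mem: "chart c u w (s, t) \<in> tile c u w" if "s \<in> {0..1}" "t \<in> {0..1}" for s t
    using that by (auto simp: tile_def cbox_Pair_eq)
  have corner: "chart c u w (0, 0) = c" "chart c u w (1, 0) = c + u"
    "chart c u w (0, 1) = c + w" "chart c u w (1, 1) = c + u + w"
    by (auto simp: chart_def)
  have qc: "q c = k 0 0 + k 0 1 * snd c + k 1 0 * fst c + k 1 1 * fst c * snd c"
    "q (c + u) = k 0 0 + k 0 1 * snd (c + u) + k 1 0 * fst (c + u) + k 1 1 * fst (c + u) * snd (c + u)"
    "q (c + w) = k 0 0 + k 0 1 * snd (c + w) + k 1 0 * fst (c + w) + k 1 1 * fst (c + w) * snd (c + w)"
    "q (c + u + w) = k 0 0 + k 0 1 * snd (c + u + w) + k 1 0 * fst (c + u + w)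
      + k 1 1 * fst (c + u + w) * snd (c + u + w)"
    using k' mem[of 0 0] mem[of 1 0] mem[of 0 1] mem[of 1 1] by (auto simp: corner)
  show ?thesis
    unfolding qc k'[OF mem[OF xy]] using ax
    by (cases rule: axes_cases) (auto simp: chart_def algebra_simps)
qed

lemma has_integral_unit_square_product:
  fixes f g :: "real \<Rightarrow> real"
  assumes f: "(f has_integral i) {0..1}" "continuous_on {0..1} f"
    and g: "(g has_integral j) {0..1}" "continuous_on {0..1} g"
  shows "((\<lambda>(x, y). f x * g y) has_integral (i * j)) (cbox (0, 0) (1, 1))"
proof -
  have c: "continuous_on (cbox (0, 0) (1, 1)) (\<lambda>(x, y). f x * g y)"
    unfolding split_def cbox_Pair_eq
    by (intro continuous_intros continuous_on_compose2[OF f(2)] continuous_on_compose2[OF g(2)]) auto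
  have "integral (cbox (0, 0) (1, 1)) (\<lambda>(x, y). f x * g y)
      = integral (cbox 0 1) (\<lambda>x. integral (cbox 0 1) (\<lambda>y. f x * g y))"
    using integral_prod_continuous[OF c] by simp
  also have "\<dots> = i * j"
    using f(1) g(1) by (simp add: integral_unique)
  finally show ?thesis
    using integrable_integral[OF integrable_continuous[OF c]] by simp
qed

lemma has_integral_cubic:
  "((\<lambda>x::real. a0 + a1 * x + a2 * x ^ 2 + a3 * x ^ 3) has_integral (a0 + a1 / 2 + a2 / 3 + a3 / 4)) {0..1}"
proof -
  have "((\<lambda>x::real. a0 + a1 * x + a2 * x ^ 2 + a3 * x ^ 3) has_integral
      ((\<lambda>x. a0 * x + a1 * x^2 / 2 + a2 * x ^ 3 / 3 + a3 * x ^ 4 / 4) 1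
       - (\<lambda>x. a0 * x + a1 * x^2 / 2 + a2 * x ^ 3 / 3 + a3 * x ^ 4 / 4) 0)) {0..1}"
    by (rule fundamental_theorem_of_calculus)
      (auto simp flip: has_real_derivative_iff_has_vector_derivative intro!: derivative_eq_intros)
  then show ?thesis by simp
qed

text \<open>
  Split \<open>q\<close> into its value on the lower edge and its increment \<open>y\<close> times an affine function with end values
  \<open>d0\<close> and \<open>d1\<close>. The first part does not contribute because \<open>1 - 2 * y\<close> has mean zero, and the second gives the
  factor \<open>1 / 6\<close> because the integral of \<open>y * (1 - 2 * y)\<close> is \<open>- 1 / 6\<close>.
\<close>

lemma cell_pairing:
  assumes ax: "axes u w" and q: "q \<in> Q_space 1 (tile c u w)"
  shows "integral (tile c u w) (\<lambda>z. q z * (- (ramp e0 e1 (coord c u z) * (1 - 2 * coord c w z))))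
    = norm u * norm w / 6 * cell_form e0 e1 (q (c + w) - q c) (q (c + u + w) - q (c + u))"
proof -
  define d0 where "d0 = q (c + w) - q c"
  define d1 where "d1 = q (c + u + w) - q (c + u)"
  define A where "A = (\<lambda>x. - (ramp e0 e1 x * ((1 - x) * q c + x * q (c + u))))"
  define g where "g = (\<lambda>x. - (ramp e0 e1 x * ((1 - x) * d0 + x * d1)))"
  have contA: "continuous_on {0..1} A" "continuous_on {0..1} g"
    unfolding A_def g_def ramp_def by (intro continuous_intros)+
  have gI: "(g has_integral (- cell_form e0 e1 d0 d1)) {0..1}"
  proof (rule has_integral_eq_rhs)
    show "(g has_integral (- (e0 * d0) + (- (e0 * d1) - e1 * d0 + 3 * e0 * d0) / 2
        + (- 3 * e0 * d0 + 2 * e0 * d1 + 2 * e1 * d0 - e1 * d1) / 3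
        + (e0 * d0 - e0 * d1 - e1 * d0 + e1 * d1) / 4)) {0..1}"
      by (rule has_integral_eq[OF _ has_integral_cubic])
        (simp add: g_def ramp_def algebra_simps power2_eq_square power3_eq_cube)
  qed (simp add: cell_form_def field_simps)
  have 1: "((\<lambda>y::real. 1 - 2 * y) has_integral 0) {0..1}"
    using has_integral_cubic[of 1 "-2" 0 0] by simp
  have 2: "((\<lambda>y::real. y * (1 - 2 * y)) has_integral (- 1 / 6)) {0..1}"
    using has_integral_cubic[of 0 1 "-2" 0] by (simp add: algebra_simps power2_eq_square)
  have AI: "(A has_integral integral {0..1} A) {0..1}"
    using contA(1) by (simp add: integrable_continuous_real integrable_integral)
  have "((\<lambda>z. (case z of (x, y) \<Rightarrow> A x * (1 - 2 * y)) + (case z of (x, y) \<Rightarrow> g x * (y * (1 - 2 * y))))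
      has_integral (integral {0..1} A * 0 + (- cell_form e0 e1 d0 d1) * (- 1 / 6))) (cbox (0, 0) (1, 1))"
    by (intro has_integral_add has_integral_unit_square_product AI gI 1 2 contA continuous_intros)
  then have "((\<lambda>z. q (chart c u w z) * (- (ramp e0 e1 (coord c u (chart c u w z)) * (1 - 2 * coord c w (chart c u w z)))))
      has_integral (cell_form e0 e1 d0 d1 / 6)) (cbox (0, 0) (1, 1))"
  proof (rule has_integral_eq[rotated, THEN has_integral_eq_rhs])
    fix z :: point assume "z \<in> cbox (0, 0) (1, 1)"
    then obtain x y where z: "z = (x, y)" "x \<in> {0..1}" "y \<in> {0..1}" by (auto simp: cbox_Pair_eq)
    show "(case z of (x, y) \<Rightarrow> A x * (1 - 2 * y)) + (case z of (x, y) \<Rightarrow> g x * (y * (1 - 2 * y)))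
      = q (chart c u w z) * (- (ramp e0 e1 (coord c u (chart c u w z)) * (1 - 2 * coord c w (chart c u w z))))"
      unfolding z(1) bilinear_on_tile[OF ax q z(2,3)] using coord_chart[OF ax, of c "(x, y)"]
      by (simp add: A_def g_def d0_def d1_def algebra_simps)
  qed simp
  from integral_unique[OF has_integral_chart[OF ax this]] show ?thesis
    unfolding tile_def d0_def d1_def by simp
qed

lemma content_tile: "axes u w \<Longrightarrow> measure lborel (tile c u w) = norm u * norm w"
proof -
  assume "axes u w"
  then have "measure lborel (tile c u w) = norm u * norm w * measure lborel (cbox (0::real,0::real) (1,1))"
    unfolding tile_def using chart_cbox by metis
  then show ?thesis by (simp add: content_Pair)
qed

lemma integral_tile_le:
  fixes f :: "point \<Rightarrow> real"
  assumes ax: "axes u w" and f: "continuous_on (tile c u w) f" and B: "\<And>z. z \<in> tile c u w \<Longrightarrow> f z \<le> B"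
  shows "integral (tile c u w) f \<le> norm u * norm w * B"
proof -
  obtain p q where pq: "tile c u w = cbox p q" using tile_cbox[OF ax] by metis
  have "integral (tile c u w) f \<le> integral (tile c u w) (\<lambda>_. B)"
    using f B unfolding pq by (intro integral_le integrable_continuous) auto
  also have "\<dots> = norm u * norm w * B"
    using content_tile[OF ax, of c] by (simp add: pq)
  finally show ?thesis .
qed

lemma convex_combination_square_le:
  fixes a b s :: real
  assumes "s \<in> {0..1}"
  shows "((1 - s) * a + s * b)\<^sup>2 \<le> (1 - s) * a\<^sup>2 + s * b\<^sup>2"
proof -
  have "(1 - s) * a\<^sup>2 + s * b\<^sup>2 - ((1 - s) * a + s * b)\<^sup>2 = s * (1 - s) * (a - b)\<^sup>2"
    by (simp add: algebra_simps power2_eq_square)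
  moreover have "s * (1 - s) * (a - b)\<^sup>2 \<ge> 0" using assms by simp
  ultimately show ?thesis by linarith
qed

lemma ramp_bounds:
  assumes "s \<in> {0..1}"
  shows "(ramp e0 e1 s)\<^sup>2 \<le> e0\<^sup>2 + e1\<^sup>2" and "(ramp' e0 e1 s)\<^sup>2 \<le> 8 * (e0\<^sup>2 + e1\<^sup>2)"
proof -
  have "((1 - s) * e0 + s * e1)\<^sup>2 \<le> (1 - s) * e0\<^sup>2 + s * e1\<^sup>2"
    using assms by (rule convex_combination_square_le)
  also have "\<dots> \<le> 1 * e0\<^sup>2 + 1 * e1\<^sup>2"
    using assms by (intro add_mono mult_right_mono) auto
  finally have "((1 - s) * e0 + s * e1)\<^sup>2 \<le> e0\<^sup>2 + e1\<^sup>2" by simp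
  moreover have "(1 - s)\<^sup>2 \<le> 1" using assms by (simp add: power_le_one)
  ultimately have "(1 - s)\<^sup>2 * ((1 - s) * e0 + s * e1)\<^sup>2 \<le> 1 * (e0\<^sup>2 + e1\<^sup>2)"
    by (intro mult_mono) auto
  then show "(ramp e0 e1 s)\<^sup>2 \<le> e0\<^sup>2 + e1\<^sup>2"
    by (simp add: ramp_def power_mult_distrib mult.commute)
  have "(ramp' e0 e1 s)\<^sup>2 \<le> 2 * ((1 - 2 * s) * e1)\<^sup>2 + 2 * (2 * (1 - s) * e0)\<^sup>2"
    using zero_le_power2[of "(1 - 2 * s) * e1 + 2 * (1 - s) * e0"]
    by (simp add: ramp'_def power2_eq_square algebra_simps)
  also have "\<dots> = 2 * ((1 - 2 * s)\<^sup>2 * e1\<^sup>2) + 8 * ((1 - s)\<^sup>2 * e0\<^sup>2)"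
    by (simp add: power2_eq_square algebra_simps)
  also have "\<dots> \<le> 2 * (1 * e1\<^sup>2) + 8 * (1 * e0\<^sup>2)"
  proof -
    have "(1 - 2 * s)\<^sup>2 \<le> 1" using assms by (simp add: abs_square_le_1 abs_le_iff)
    then show ?thesis using \<open>(1 - s)\<^sup>2 \<le> 1\<close>
      by (intro add_mono mult_left_mono mult_right_mono) auto
  qed
  finally show "(ramp' e0 e1 s)\<^sup>2 \<le> 8 * (e0\<^sup>2 + e1\<^sup>2)" by (simp add: algebra_simps) (smt (verit) zero_le_power2)
qed

lemma cell_energy:
  assumes ax: "axes u w" and \<rho>: "norm w \<le> \<rho> * norm u"
  shows "integral (tile c u w) (\<lambda>z. \<Sum>b\<in>Basis. (norm (cell_deriv c u w e0 e1 z b))\<^sup>2)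
    \<le> norm u * norm w * ((8 * \<rho>\<^sup>2 + 1) * (e0\<^sup>2 + e1\<^sup>2))"
proof (rule integral_tile_le[OF ax])
  show "continuous_on (tile c u w) (\<lambda>z. \<Sum>b\<in>Basis. (norm (cell_deriv c u w e0 e1 z b))\<^sup>2)"
    by (intro continuous_intros continuous_on_cell_deriv)
next
  fix z assume z: "z \<in> tile c u w"
  define s where "s = coord c u z"
  define t where "t = coord c w z"
  have st: "s \<in> {0..1}" "t \<in> {0..1}" using z by (auto simp: mem_tile[OF ax] s_def t_def)
  have "norm w / norm u \<le> \<rho>" using ax \<rho> by (simp add: axes_def field_simps)
  then have r: "(norm w / norm u)\<^sup>2 \<le> \<rho>\<^sup>2" by (intro power_mono) auto
  have b: "(bubble t)\<^sup>2 \<le> 1"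
    using st by (auto simp: bubble_def power_le_one mult_le_one)
  have "(ramp' e0 e1 s * bubble t)\<^sup>2 \<le> 8 * (e0\<^sup>2 + e1\<^sup>2) * 1"
    unfolding power_mult_distrib using ramp_bounds(2)[OF st(1)] b by (intro mult_mono) auto
  then have 1: "(norm w / norm u)\<^sup>2 * (ramp' e0 e1 s * bubble t)\<^sup>2 \<le> \<rho>\<^sup>2 * (8 * (e0\<^sup>2 + e1\<^sup>2))"
    using r by (intro mult_mono) auto
  have "(1 - 2 * t)\<^sup>2 \<le> 1" using st by (simp add: abs_square_le_1 abs_le_iff)
  then have 2: "(ramp e0 e1 s * (1 - 2 * t))\<^sup>2 \<le> (e0\<^sup>2 + e1\<^sup>2) * 1"
    unfolding power_mult_distrib using ramp_bounds(1)[OF st(1)] by (intro mult_mono) auto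
  from 1 2 show "(\<Sum>b\<in>Basis. (norm (cell_deriv c u w e0 e1 z b))\<^sup>2) \<le> (8 * \<rho>\<^sup>2 + 1) * (e0\<^sup>2 + e1\<^sup>2)"
    unfolding cell_gradient[OF ax] s_def[symmetric] t_def[symmetric] by (simp add: algebra_simps)
qed

text \<open>
  A bilinear function is a convex combination of its corner values.
\<close>

lemma integral_square_le_corners:
  assumes ax: "axes u w" and q: "q \<in> Q_space 1 (tile c u w)" "continuous_on (tile c u w) q"
  shows "integral (tile c u w) (\<lambda>z. (q z - k)\<^sup>2)
    \<le> norm u * norm w * ((q c - k)\<^sup>2 + (q (c + u) - k)\<^sup>2 + (q (c + w) - k)\<^sup>2 + (q (c + u + w) - k)\<^sup>2)"
proof (rule integral_tile_le[OF ax])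
  show "continuous_on (tile c u w) (\<lambda>z. (q z - k)\<^sup>2)" by (intro continuous_intros q)
next
  fix z assume "z \<in> tile c u w"
  then obtain x y where z: "z = chart c u w (x, y)" and xy: "x \<in> {0..1}" "y \<in> {0..1}"
    by (auto simp: tile_def cbox_Pair_eq)
  have conv: "((1 - s) * a + s * b)\<^sup>2 \<le> a\<^sup>2 + b\<^sup>2" if "s \<in> {0..1}" for a b s :: real
  proof -
    have "(1 - s) * a\<^sup>2 + s * b\<^sup>2 \<le> 1 * a\<^sup>2 + 1 * b\<^sup>2"
      using that by (intro add_mono mult_right_mono) auto
    with convex_combination_square_le[OF that, of a b] show ?thesis by simp
  qed
  have "q z - k = (1 - y) * ((1 - x) * (q c - k) + x * (q (c + u) - k))
      + y * ((1 - x) * (q (c + w) - k) + x * (q (c + u + w) - k))"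
    unfolding z bilinear_on_tile[OF ax q(1) xy] by (simp add: algebra_simps)
  then have "(q z - k)\<^sup>2 \<le> ((1 - x) * (q c - k) + x * (q (c + u) - k))\<^sup>2
      + ((1 - x) * (q (c + w) - k) + x * (q (c + u + w) - k))\<^sup>2"
    using conv[OF xy(2)] by simp
  also have "\<dots> \<le> ((q c - k)\<^sup>2 + (q (c + u) - k)\<^sup>2) + ((q (c + w) - k)\<^sup>2 + (q (c + u + w) - k)\<^sup>2)"
    by (intro add_mono conv[OF xy(1)])
  finally show "(q z - k)\<^sup>2 \<le> (q c - k)\<^sup>2 + (q (c + u) - k)\<^sup>2 + (q (c + w) - k)\<^sup>2 + (q (c + u + w) - k)\<^sup>2"
    by simp
qed

section \<open>Estimates from a single test velocity\<close>

text \<open>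
  The left tile has to be a cell only when \<open>e0\<close> or \<open>e2\<close> is nonzero: with \<open>e0 = e2 = 0\<close> the field is the bubble
  of the right cell, and row fields and cell bubbles are treated together.
\<close>

context
  fixes \<omega> :: "point set" and P :: "point set set" and c u w :: point and e0 e1 e2 :: real
  assumes t: "tiling \<omega> P" and ax: "axes u w" and right: "tile c u w \<in> P"
    and left: "e0 = 0 \<and> e2 = 0 \<or> tile c (- u) w \<in> P"
begin

definition "strip_piece K = (if K = tile c u w then cell_field c u w e0 e1
    else if K = tile c (- u) w then cell_field c (- u) w e0 e2 else (\<lambda>_. 0))"

definition "strip_piece_deriv K = (if K = tile c u w then cell_deriv c u w e0 e1
    else if K = tile c (- u) w then cell_deriv c (- u) w e0 e2 else (\<lambda>_ _. 0))"

lemma tile_neq: "tile c u w \<noteq> tile c (- u) w"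
proof -
  have "c + u \<in> tile c u w"
    unfolding tile_def by (rule image_eqI[of _ _ "(1, 0)"]) (auto simp: chart_def cbox_Pair_eq)
  moreover have "coord c u (c + u) = 1" using ax by (simp add: coord_def axes_def)
  then have "c + u \<notin> tile c (- u) w"
    using mem_tile[OF axes_uminus[OF ax]] by (simp add: coord_uminus)
  ultimately show ?thesis by blast
qed

definition "strip_cells = (if e0 = 0 \<and> e2 = 0 then {tile c u w} else {tile c u w, tile c (- u) w})"

lemma strip_field_open_support: "open {z. strip_field c u w e0 e1 e2 z \<noteq> 0}"
proof -
  have "{z. strip_field c u w e0 e1 e2 z \<noteq> 0} = strip_field c u w e0 e1 e2 -` (- {0})" by auto
  then show ?thesis
    by (simp only:) (intro open_vimage continuous_strip_field open_Compl closed_singleton)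
qed

lemma strip_field_support_cells: "strip_cells \<subseteq> P" "{z. strip_field c u w e0 e1 e2 z \<noteq> 0} \<subseteq> \<Union>strip_cells"
  using left right strip_field_support[OF ax, of c e0 e1 e2] by (auto simp: strip_cells_def)

lemma strip_field_cellwise:
  assumes K: "K \<in> P" "z \<in> K"
  shows "strip_field c u w e0 e1 e2 z = strip_piece K z"
proof -
  consider "K = tile c u w" | "K = tile c (- u) w" | "K \<noteq> tile c u w" "K \<noteq> tile c (- u) w" by blast
  then show ?thesis
  proof cases
    case 1
    then show ?thesis using strip_field_right[OF ax, of z c] K by (simp add: strip_piece_def)
  next
    case 2
    then show ?thesis using strip_field_left[OF ax, of z c] K tile_neq by (simp add: strip_piece_def)
  next
    case 3
    then have "K \<notin> strip_cells" by (auto simp: strip_cells_def)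
    then have "K \<inter> {z. strip_field c u w e0 e1 e2 z \<noteq> 0} = {}"
      by (rule disjoint_from_other_cells[OF t strip_field_support_cells(1) K(1) _
            strip_field_open_support strip_field_support_cells(2)])
    then show ?thesis using K 3 by (auto simp: strip_piece_def)
  qed
qed

lemma strip_field_in_velocity_space: "strip_field c u w e0 e1 e2 \<in> velocity_space \<omega> P"
proof -
  have z: "(\<lambda>_. 0) \<in> Q_space 2 K" for K by (auto simp: Q_space_def intro!: exI[of _ "\<lambda>_ _. 0"])
  have piece: "fst \<circ> strip_piece K \<in> Q_space 2 K \<and> snd \<circ> strip_piece K \<in> Q_space 2 K" for K
    using z cell_field_in_Q_space ax axes_uminus[OF ax] by (auto simp: strip_piece_def o_def)
  have Q: "f \<in> Q_space 2 K" if "g \<in> Q_space 2 K" "\<And>z. z \<in> K \<Longrightarrow> f z = g z" for f g K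
    using that by (fastforce simp: Q_space_def)
  have K: "fst \<circ> strip_field c u w e0 e1 e2 \<in> Q_space 2 K \<and> snd \<circ> strip_field c u w e0 e1 e2 \<in> Q_space 2 K"
    if "K \<in> P" for K
    using Q[OF conjunct1[OF piece]] Q[OF conjunct2[OF piece]] strip_field_cellwise[OF that] by simp
  have "strip_field c u w e0 e1 e2 z = 0" if "z \<in> frontier \<omega>" for z
  proof (rule ccontr)
    let ?U = "{z. strip_field c u w e0 e1 e2 z \<noteq> 0}"
    assume "strip_field c u w e0 e1 e2 z \<noteq> 0"
    moreover have "?U \<subseteq> \<omega>"
      using strip_field_support_cells(2) Union_mono[OF strip_field_support_cells(1)] t
      by (simp add: tiling_def)
    ultimately have "z \<in> interior \<omega>" using interior_maximal[OF _ strip_field_open_support] by blast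
    then show False using that by (simp add: frontier_def)
  qed
  then show ?thesis
    using K continuous_strip_field by (auto simp: velocity_space_def)
qed

lemma strip_piece_has_derivative: "(strip_piece K has_derivative strip_piece_deriv K z) (at z)"
  by (auto simp: strip_piece_def strip_piece_deriv_def cell_field_has_derivative)

lemma sum_over_strip:
  fixes F :: "point set \<Rightarrow> real"
  assumes "\<And>K. K \<noteq> tile c u w \<Longrightarrow> K \<noteq> tile c (- u) w \<Longrightarrow> F K = 0"
  shows "sum F P = F (tile c u w) + (if tile c (- u) w \<in> P then F (tile c (- u) w) else 0)"
proof -
  have fin: "finite P" using t by (simp add: tiling_def)
  have "sum F P = sum F (P \<inter> {tile c u w, tile c (- u) w})"
    by (rule sum.mono_neutral_right[OF fin]) (use assms in auto)
  also have "P \<inter> {tile c u w, tile c (- u) w}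
      = (if tile c (- u) w \<in> P then {tile c u w, tile c (- u) w} else {tile c u w})"
    using right by auto
  finally show ?thesis using tile_neq by auto
qed

lemma strip_field_pairing:
  assumes q: "continuous_on \<omega> q" "\<And>K. K \<in> P \<Longrightarrow> q \<in> Q_space 1 K"
  shows "(LINT z:\<omega>|lebesgue. q z * divergence (strip_field c u w e0 e1 e2) z)
    = norm u * norm w / 6 * (cell_form e0 e1 (q (c + w) - q c) (q (c + u + w) - q (c + u))
        + cell_form e0 e2 (q (c + w) - q c) (q (c - u + w) - q (c - u)))"
proof -
  have "(LINT z:\<omega>|lebesgue. q z * divergence (strip_field c u w e0 e1 e2) z)
      = (\<Sum>K\<in>P. integral K (\<lambda>z. q z * (\<Sum>b\<in>Basis. strip_piece_deriv K z b \<bullet> b)))"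
    by (rule cellwise_forms(1)[OF t strip_field_cellwise strip_piece_has_derivative _ q(1)])
      (auto simp: strip_piece_deriv_def intro: continuous_on_cell_deriv)
  also have "\<dots> = integral (tile c u w) (\<lambda>z. q z * (\<Sum>b\<in>Basis. strip_piece_deriv (tile c u w) z b \<bullet> b))
      + (if tile c (- u) w \<in> P then integral (tile c (- u) w) (\<lambda>z. q z * (\<Sum>b\<in>Basis. strip_piece_deriv (tile c (- u) w) z b \<bullet> b)) else 0)"
    by (rule sum_over_strip) (simp add: strip_piece_deriv_def)
  also have "integral (tile c u w) (\<lambda>z. q z * (\<Sum>b\<in>Basis. strip_piece_deriv (tile c u w) z b \<bullet> b))
      = norm u * norm w / 6 * cell_form e0 e1 (q (c + w) - q c) (q (c + u + w) - q (c + u))"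
    using cell_pairing[OF ax q(2)[OF right]] by (simp add: strip_piece_deriv_def cell_divergence[OF ax])
  also have "(if tile c (- u) w \<in> P then integral (tile c (- u) w) (\<lambda>z. q z * (\<Sum>b\<in>Basis. strip_piece_deriv (tile c (- u) w) z b \<bullet> b)) else 0)
      = norm u * norm w / 6 * cell_form e0 e2 (q (c + w) - q c) (q (c - u + w) - q (c - u))"
  proof (cases "tile c (- u) w \<in> P")
    case True
    then show ?thesis
      using cell_pairing[OF axes_uminus[OF ax] q(2)[OF True]] tile_neq
      by (simp add: strip_piece_deriv_def cell_divergence[OF axes_uminus[OF ax]])
  next
    case False
    then show ?thesis using left by (simp add: cell_form_def)
  qed
  finally show ?thesis by (simp add: algebra_simps)
qed

lemma strip_field_energy:
  assumes \<rho>: "norm w \<le> \<rho> * norm u"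
  shows "(H1_seminorm_on \<omega> (strip_field c u w e0 e1 e2))\<^sup>2
      \<le> norm u * norm w * ((8 * \<rho>\<^sup>2 + 1) * (2 * e0\<^sup>2 + e1\<^sup>2 + e2\<^sup>2))"
    and "set_integrable lebesgue \<omega> (\<lambda>z. \<Sum>b\<in>Basis. (norm (frechet_derivative (strip_field c u w e0 e1 e2) (at z) b))\<^sup>2)"
proof -
  let ?I = "LINT z:\<omega>|lebesgue. \<Sum>b\<in>Basis. (norm (frechet_derivative (strip_field c u w e0 e1 e2) (at z) b))\<^sup>2"
  let ?R = "8 * \<rho>\<^sup>2 + 1"
  show "set_integrable lebesgue \<omega> (\<lambda>z. \<Sum>b\<in>Basis. (norm (frechet_derivative (strip_field c u w e0 e1 e2) (at z) b))\<^sup>2)"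
    by (rule cellwise_forms(2)[OF t strip_field_cellwise strip_piece_has_derivative _ continuous_on_const])
      (auto simp: strip_piece_deriv_def intro: continuous_on_cell_deriv)
  have "?I = (\<Sum>K\<in>P. integral K (\<lambda>z. \<Sum>b\<in>Basis. (norm (strip_piece_deriv K z b))\<^sup>2))"
    by (rule cellwise_forms(3)[OF t strip_field_cellwise strip_piece_has_derivative _ continuous_on_const])
      (auto simp: strip_piece_deriv_def intro: continuous_on_cell_deriv)
  also have "\<dots> = integral (tile c u w) (\<lambda>z. \<Sum>b\<in>Basis. (norm (strip_piece_deriv (tile c u w) z b))\<^sup>2)
      + (if tile c (- u) w \<in> P then integral (tile c (- u) w) (\<lambda>z. \<Sum>b\<in>Basis. (norm (strip_piece_deriv (tile c (- u) w) z b))\<^sup>2) else 0)"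
    by (rule sum_over_strip) (simp add: strip_piece_deriv_def)
  also have "\<dots> \<le> norm u * norm w * (?R * (e0\<^sup>2 + e1\<^sup>2)) + norm u * norm w * (?R * (e0\<^sup>2 + e2\<^sup>2))"
  proof (rule add_mono)
    show "integral (tile c u w) (\<lambda>z. \<Sum>b\<in>Basis. (norm (strip_piece_deriv (tile c u w) z b))\<^sup>2)
        \<le> norm u * norm w * (?R * (e0\<^sup>2 + e1\<^sup>2))"
      using cell_energy[OF ax \<rho>] by (simp add: strip_piece_deriv_def)
    show "(if tile c (- u) w \<in> P then integral (tile c (- u) w) (\<lambda>z. \<Sum>b\<in>Basis. (norm (strip_piece_deriv (tile c (- u) w) z b))\<^sup>2) else 0)
        \<le> norm u * norm w * (?R * (e0\<^sup>2 + e2\<^sup>2))"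
      using cell_energy[OF axes_uminus[OF ax], of \<rho> c e0 e2] \<rho> tile_neq by (simp add: strip_piece_deriv_def)
  qed
  also have "\<dots> = norm u * norm w * (?R * (2 * e0\<^sup>2 + e1\<^sup>2 + e2\<^sup>2))"
    by (simp add: algebra_simps)
  finally have "?I \<le> norm u * norm w * (?R * (2 * e0\<^sup>2 + e1\<^sup>2 + e2\<^sup>2))" .
  moreover have "0 \<le> ?I"
    unfolding set_lebesgue_integral_def by (rule Bochner_Integration.integral_nonneg) (auto intro!: mult_nonneg_nonneg sum_nonneg)
  ultimately show "(H1_seminorm_on \<omega> (strip_field c u w e0 e1 e2))\<^sup>2
      \<le> norm u * norm w * (?R * (2 * e0\<^sup>2 + e1\<^sup>2 + e2\<^sup>2))"
    by (simp add: H1_seminorm_on_def)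
qed

end

text \<open>
  The pressure \<open>q\<close> is a counterexample to every inf-sup constant larger than \<open>\<beta>\<close>.
\<close>

definition inf_sup_below :: "real \<Rightarrow> point set \<Rightarrow> point set set \<Rightarrow> (point \<Rightarrow> real) \<Rightarrow> bool" where
  "inf_sup_below \<beta> \<omega> P q \<longleftrightarrow> (\<forall>v\<in>velocity_space \<omega> P. (\<exists>x\<in>\<omega>. v x \<noteq> 0) \<longrightarrow>
     (LINT x:\<omega>|lebesgue. q x * divergence v x) / (H1_seminorm_on \<omega> v * L2_norm_on \<omega> q) \<le> \<beta>)"

text \<open>
  Testing the quotient with one field: the pairing is at least \<open>m / 144\<close> and the squared energy norm at most
  a multiple of \<open>m\<close>, where \<open>m = |u| |w| S\<close>. So \<open>m\<close> is bounded by a multiple of \<open>\<beta> \<parallel>q\<parallel> sqrt m\<close>, and dividing by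
  \<open>sqrt m\<close> gives the claim.
\<close>

lemma strip_test:
  assumes t: "tiling \<omega> P" and ax: "axes u w" and right: "tile c u w \<in> P"
    and left: "e0 = 0 \<and> e2 = 0 \<or> tile c (- u) w \<in> P"
    and \<rho>: "norm w \<le> \<rho> * norm u"
    and q: "q \<in> pressure_space \<omega> P" "L2_norm_on \<omega> q > 0" "inf_sup_below \<beta> \<omega> P q" and \<beta>: "\<beta> > 0"
    and S: "S = 2 * e0\<^sup>2 + e1\<^sup>2 + e2\<^sup>2"
    and lower: "S / 24 \<le> cell_form e0 e1 (q (c + w) - q c) (q (c + u + w) - q (c + u))
        + cell_form e0 e2 (q (c + w) - q c) (q (c - u + w) - q (c - u))"
  shows "norm u * norm w * S \<le> 144\<^sup>2 * (8 * \<rho>\<^sup>2 + 1) * (\<beta> * L2_norm_on \<omega> q)\<^sup>2"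
proof -
  define v where "v = strip_field c u w e0 e1 e2"
  define b where "b = (LINT z:\<omega>|lebesgue. q z * divergence v z)"
  define m where "m = norm u * norm w * S"
  have qc: "continuous_on \<omega> q" "\<And>K. K \<in> P \<Longrightarrow> q \<in> Q_space 1 K"
    using q(1) by (auto simp: pressure_space_def)
  have b: "m / 144 \<le> b"
  proof -
    have bq: "b = norm u * norm w / 6 * (cell_form e0 e1 (q (c + w) - q c) (q (c + u + w) - q (c + u))
        + cell_form e0 e2 (q (c + w) - q c) (q (c - u + w) - q (c - u)))"
      unfolding b_def v_def by (rule strip_field_pairing[OF t ax right left qc])
    have "norm u * norm w / 6 * (S / 24) \<le> b"
      unfolding bq by (rule mult_left_mono[OF lower]) simp
    then show ?thesis by (simp add: m_def)
  qed
  have m0: "m \<ge> 0" by (simp add: m_def S)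
  have H: "(H1_seminorm_on \<omega> v)\<^sup>2 \<le> (8 * \<rho>\<^sup>2 + 1) * m"
    using strip_field_energy(1)[OF t ax right left \<rho>] by (simp add: v_def m_def S mult_ac)
  have H0: "H1_seminorm_on \<omega> v \<ge> 0"
    by (auto simp: H1_seminorm_on_def set_lebesgue_integral_def intro!: Bochner_Integration.integral_nonneg mult_nonneg_nonneg sum_nonneg)
  show ?thesis
  proof (cases "b = 0")
    case True
    then have "m = 0" using b m0 by simp
    then show ?thesis unfolding m_def[symmetric] by simp
  next
    case False
    have "H1_seminorm_on \<omega> v \<noteq> 0"
      using pairing_zero_if_seminorm_zero[OF strip_field_energy(2)[OF t ax right left \<rho>]] False
      by (auto simp: b_def v_def)
    with H0 have Hpos: "H1_seminorm_on \<omega> v > 0" by simp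
    have "\<exists>x\<in>\<omega>. v x \<noteq> 0"
      using pairing_zero_if_field_zero[OF t qc(1)] False by (auto simp: b_def)
    then have "b / (H1_seminorm_on \<omega> v * L2_norm_on \<omega> q) \<le> \<beta>"
      using q(3) strip_field_in_velocity_space[OF t ax right left, of e1]
      unfolding inf_sup_below_def b_def v_def by blast
    then have "b \<le> \<beta> * L2_norm_on \<omega> q * H1_seminorm_on \<omega> v"
      using Hpos q(2) by (simp add: divide_le_eq mult_ac)
    then have "m \<le> 144 * (\<beta> * L2_norm_on \<omega> q * H1_seminorm_on \<omega> v)" using b by simp
    then have "m\<^sup>2 \<le> (144 * (\<beta> * L2_norm_on \<omega> q * H1_seminorm_on \<omega> v))\<^sup>2"
      using m0 by (intro power_mono)
    also have "\<dots> = 144\<^sup>2 * (\<beta> * L2_norm_on \<omega> q)\<^sup>2 * (H1_seminorm_on \<omega> v)\<^sup>2"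
      by (simp add: power_mult_distrib)
    also have "\<dots> \<le> 144\<^sup>2 * (\<beta> * L2_norm_on \<omega> q)\<^sup>2 * ((8 * \<rho>\<^sup>2 + 1) * m)"
      using H by (intro mult_left_mono) auto
    finally have *: "m * m \<le> (144\<^sup>2 * (8 * \<rho>\<^sup>2 + 1) * (\<beta> * L2_norm_on \<omega> q)\<^sup>2) * m"
      by (simp add: power2_eq_square mult_ac)
    show ?thesis
    proof (cases "m = 0")
      case False
      then show ?thesis unfolding m_def[symmetric] using m0 mult_right_le_imp_le[OF *] by simp
    qed (simp add: m_def[symmetric])
  qed
qed

lemma cell_form_lower: "(d0\<^sup>2 + d1\<^sup>2) / 24 \<le> cell_form d0 d1 d0 d1"
proof -
  \<comment> \<open>completing the square\<close>
  have "cell_form d0 d1 d0 d1 - (d0\<^sup>2 + d1\<^sup>2) / 24 = (4 * d0 + 2 * d1)\<^sup>2 / 96 + (d0\<^sup>2) / 24"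
    by (simp add: cell_form_def power2_eq_square field_simps)
  then show ?thesis by (smt (verit) divide_nonneg_pos zero_le_power2)
qed

text \<open>
  The coefficients of the field are the edge differences themselves, so the pairing is a positive
  definite quadratic form of them by \<open>cell_form_lower\<close>.
\<close>

lemma strip_estimate:
  assumes t: "tiling \<omega> P" and ax: "axes u w" and right: "tile c u w \<in> P" and left: "tile c (- u) w \<in> P"
    and \<rho>: "norm w \<le> \<rho> * norm u"
    and q: "q \<in> pressure_space \<omega> P" "L2_norm_on \<omega> q > 0" "inf_sup_below \<beta> \<omega> P q" and \<beta>: "\<beta> > 0"
  shows "norm u * norm w * ((q (c + w) - q c)\<^sup>2 + (q (c + u + w) - q (c + u))\<^sup>2 + (q (c - u + w) - q (c - u))\<^sup>2)
    \<le> 144\<^sup>2 * (8 * \<rho>\<^sup>2 + 1) * (\<beta> * L2_norm_on \<omega> q)\<^sup>2"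
proof -
  define d0 where "d0 = q (c + w) - q c"
  define d1 where "d1 = q (c + u + w) - q (c + u)"
  define d2 where "d2 = q (c - u + w) - q (c - u)"
  have "norm u * norm w * (d0\<^sup>2 + d1\<^sup>2 + d2\<^sup>2) \<le> norm u * norm w * (2 * d0\<^sup>2 + d1\<^sup>2 + d2\<^sup>2)"
    by (intro mult_left_mono) auto
  also have "\<dots> \<le> 144\<^sup>2 * (8 * \<rho>\<^sup>2 + 1) * (\<beta> * L2_norm_on \<omega> q)\<^sup>2"
  proof (rule strip_test[OF t ax right disjI2[OF left] \<rho> q \<beta> refl])
    show "(2 * d0\<^sup>2 + d1\<^sup>2 + d2\<^sup>2) / 24 \<le> cell_form d0 d1 (q (c + w) - q c) (q (c + u + w) - q (c + u))
        + cell_form d0 d2 (q (c + w) - q c) (q (c - u + w) - q (c - u))"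
      using cell_form_lower[of d0 d1] cell_form_lower[of d0 d2]
      unfolding d0_def[symmetric] d1_def[symmetric] d2_def[symmetric] by (simp add: field_simps)
  qed
  finally show ?thesis by (simp add: d0_def d1_def d2_def)
qed

text \<open>
  With the bubble only the mean of the two edge differences is visible.
\<close>

lemma cell_estimate:
  assumes t: "tiling \<omega> P" and ax: "axes u w" and K: "tile c u w \<in> P"
    and \<rho>: "norm w \<le> \<rho> * norm u"
    and q: "q \<in> pressure_space \<omega> P" "L2_norm_on \<omega> q > 0" "inf_sup_below \<beta> \<omega> P q" and \<beta>: "\<beta> > 0"
  shows "norm u * norm w * ((q (c + w) - q c) + (q (c + u + w) - q (c + u)))\<^sup>2
    \<le> 144\<^sup>2 * (8 * \<rho>\<^sup>2 + 1) * (\<beta> * L2_norm_on \<omega> q)\<^sup>2"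
proof -
  define d where "d = (q (c + w) - q c) + (q (c + u + w) - q (c + u))"
  show ?thesis
    unfolding d_def[symmetric]
  proof (rule strip_test[OF t ax K disjI1 \<rho> q \<beta>, of 0 0 _ d])
    show "d\<^sup>2 / 24 \<le> cell_form 0 d (q (c + w) - q c) (q (c + u + w) - q (c + u))
        + cell_form 0 0 (q (c + w) - q c) (q (c - u + w) - q (c - u))"
    proof -
      have "cell_form 0 d (q (c + w) - q c) (q (c + u + w) - q (c + u))
          = d * ((q (c + w) - q c) + (q (c + u + w) - q (c + u))) / 12"
        by (simp add: cell_form_def algebra_simps add_divide_distrib diff_divide_distrib)
      also have "\<dots> = d\<^sup>2 / 12" unfolding d_def[symmetric] by (simp add: power2_eq_square)
      finally have eq: "cell_form 0 d (q (c + w) - q c) (q (c + u + w) - q (c + u)) = d\<^sup>2 / 12" .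
      show ?thesis unfolding eq by (simp add: cell_form_def)
    qed
  qed auto
qed

section \<open>Pressure norms and patches in chart coordinates\<close>

lemma L2_norm_nonneg: "0 \<le> L2_norm_on \<omega> q"
  by (auto simp: L2_norm_on_def set_lebesgue_integral_def intro!: Bochner_Integration.integral_nonneg mult_nonneg_nonneg)

lemma L2_norm_square: "(L2_norm_on \<omega> q)\<^sup>2 = (LINT z:\<omega>|lebesgue. (q z)\<^sup>2)"
  by (auto simp: L2_norm_on_def set_lebesgue_integral_def intro!: Bochner_Integration.integral_nonneg mult_nonneg_nonneg)

text \<open>
  A function of mean zero is orthogonal to constants, so subtracting a constant cannot decrease its norm.
\<close>

lemma pressure_norm_le_deviation:
  assumes t: "tiling \<omega> P" and q: "q \<in> pressure_space \<omega> P"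
  shows "(L2_norm_on \<omega> q)\<^sup>2 \<le> (\<Sum>K\<in>P. integral K (\<lambda>z. (q z - k)\<^sup>2))"
proof -
  have qK: "continuous_on K q" if "K \<in> P" for K
    using q continuous_on_subset tiling_subset[OF t that] by (auto simp: pressure_space_def)
  have int: "set_integrable lebesgue \<omega> q" "set_integrable lebesgue \<omega> (\<lambda>z. (q z)\<^sup>2)"
    "set_integrable lebesgue \<omega> (\<lambda>z. k\<^sup>2)"
    using cellwise_integral(1)[OF t, of q "\<lambda>_. q"]
      cellwise_integral(1)[OF t, of "\<lambda>z. (q z)\<^sup>2" "\<lambda>_ z. (q z)\<^sup>2"]
      cellwise_integral(1)[OF t, of "\<lambda>z. k\<^sup>2" "\<lambda>_ z. k\<^sup>2"]
    by (simp_all add: qK continuous_on_power)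
  have "(\<Sum>K\<in>P. integral K (\<lambda>z. (q z - k)\<^sup>2)) = (LINT z:\<omega>|lebesgue. (q z - k)\<^sup>2)"
    by (rule cellwise_integral(2)[OF t, symmetric]) (auto intro!: continuous_intros qK)
  also have "\<dots> = (LINT z:\<omega>|lebesgue. ((q z)\<^sup>2 - 2 * k * q z) + k\<^sup>2)"
    by (simp add: power2_diff algebra_simps)
  also have "\<dots> = (LINT z:\<omega>|lebesgue. (q z)\<^sup>2) - 2 * k * (LINT z:\<omega>|lebesgue. q z) + (LINT z:\<omega>|lebesgue. k\<^sup>2)"
    using int by (simp add: set_integral_add set_integral_diff)
  also have "\<dots> = (L2_norm_on \<omega> q)\<^sup>2 + (LINT z:\<omega>|lebesgue. k\<^sup>2)"
    using q by (simp add: pressure_space_def L2_norm_square)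
  finally show ?thesis
    by (auto simp: set_lebesgue_integral_def intro!: Bochner_Integration.integral_nonneg mult_nonneg_nonneg)
qed

lemma L2_norm_pos:
  assumes t: "tiling \<omega> P" and q: "q \<in> pressure_space \<omega> P" and x: "x \<in> \<omega>" "q x \<noteq> 0"
  shows "L2_norm_on \<omega> q > 0"
proof (rule ccontr)
  assume "\<not> L2_norm_on \<omega> q > 0"
  then have 0: "L2_norm_on \<omega> q = 0" using L2_norm_nonneg[of \<omega> q] by simp
  have qK: "continuous_on K (\<lambda>z. (q z)\<^sup>2)" if "K \<in> P" for K
    using q continuous_on_subset tiling_subset[OF t that] by (auto simp: pressure_space_def intro!: continuous_intros)
  obtain K where K: "K \<in> P" "x \<in> K" using x t by (auto simp: tiling_def)
  obtain a b where ab: "K = cbox a b" "box a b \<noteq> {}" using tiling_cbox[OF t K(1)] .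
  have integral_square_nonneg: "0 \<le> integral K (\<lambda>z. (q z)\<^sup>2)" for K
    by (cases "(\<lambda>z. (q z)\<^sup>2) integrable_on K")
      (auto intro: Henstock_Kurzweil_Integration.integral_nonneg simp: not_integrable_integral)
  have "(\<Sum>K\<in>P. integral K (\<lambda>z. (q z)\<^sup>2)) = (L2_norm_on \<omega> q)\<^sup>2"
    unfolding L2_norm_square by (rule cellwise_integral(2)[OF t, symmetric]) (auto intro!: qK)
  then have "integral K (\<lambda>z. (q z)\<^sup>2) = 0"
    using 0 K(1) t sum_nonneg_eq_0_iff[of P "\<lambda>K. integral K (\<lambda>z. (q z)\<^sup>2)"] integral_square_nonneg
    by (simp add: tiling_def)
  then have "((\<lambda>z. (q z)\<^sup>2) has_integral 0) (cbox a b)"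
    using qK[OF K(1)] ab by (metis integrable_continuous integrable_integral)
  then have "(q x)\<^sup>2 = 0"
    using has_integral_0_cbox_imp_0[of a b "\<lambda>z. (q z)\<^sup>2" x] qK[OF K(1)] ab K by auto
  then show False using x by simp
qed

lemma tile_commute: "tile c u w = tile c w u"
proof -
  have "tile c u w \<subseteq> tile c w u" for u w
  proof
    fix z assume "z \<in> tile c u w"
    then obtain x y where z: "z = chart c u w (x, y)" "x \<in> {0..1}" "y \<in> {0..1}"
      by (auto simp: tile_def cbox_Pair_eq)
    then have "z = chart c w u (y, x)" by (simp add: chart_def)
    then show "z \<in> tile c w u" using z by (auto simp: tile_def cbox_Pair_eq)
  qed
  then show ?thesis by blast
qed

lemma tile_reflect: "tile (c + u) (- u) w = tile c u w"
proof -
  have "tile (c + u) (- u) w \<subseteq> tile c u w" for c u w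
  proof
    fix z assume "z \<in> tile (c + u) (- u) w"
    then obtain x y where z: "z = chart (c + u) (- u) w (x, y)" "x \<in> {0..1}" "y \<in> {0..1}"
      by (auto simp: tile_def cbox_Pair_eq)
    then have "z = chart c u w (1 - x, y)" by (simp add: chart_def algebra_simps)
    then show "z \<in> tile c u w" using z by (auto simp: tile_def cbox_Pair_eq)
  qed
  from this[of c u w] this[of "c + u" "- u" w] show ?thesis by auto
qed

lemma chart_rectangle:
  assumes "p \<le> p'" "r \<le> r'"
  shows "chart c u w ` ({p..p'} \<times> {r..r'}) = tile (chart c u w (p, r)) ((p' - p) *\<^sub>R u) ((r' - r) *\<^sub>R w)"
proof -
  have i: "{a..b} = (\<lambda>s. a + s * (b - a)) ` {0..1}" if "a \<le> b" for a b :: real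
    using image_affinity_atLeastAtMost[of "b - a" a 0 1] that by (simp add: mult.commute add.commute)
  have "{p..p'} \<times> {r..r'} = (\<lambda>z. (p + fst z * (p' - p), r + snd z * (r' - r))) ` ({0..1} \<times> {0..1})"
    unfolding i[OF assms(1)] i[OF assms(2)] by force
  then have "chart c u w ` ({p..p'} \<times> {r..r'})
      = (\<lambda>z. chart c u w (p + fst z * (p' - p), r + snd z * (r' - r))) ` ({0..1} \<times> {0..1})"
    by (simp add: image_image)
  also have "\<dots> = tile (chart c u w (p, r)) ((p' - p) *\<^sub>R u) ((r' - r) *\<^sub>R w)"
    unfolding tile_def cbox_Pair_eq by (intro image_cong) (auto simp: chart_def algebra_simps)
  finally show ?thesis .
qed

text \<open>
  A checkable criterion for negligible overlap of axis-parallel rectangles.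
\<close>

definition separated :: "point set \<Rightarrow> point set \<Rightarrow> bool" where
  "separated K K' \<longleftrightarrow> (\<exists>s. K \<inter> K' \<subseteq> {z. fst z = s}) \<or> (\<exists>s. K \<inter> K' \<subseteq> {z. snd z = s})"

lemma separated_intervals:
  "p' \<le> s \<Longrightarrow> separated ({p..p'} \<times> Y) ({s..s'} \<times> Y')"
  "p' \<le> s \<Longrightarrow> separated ({s..s'} \<times> Y) ({p..p'} \<times> Y')"
  "p' \<le> s \<Longrightarrow> separated (Y \<times> {p..p'}) (Y' \<times> {s..s'})"
  "p' \<le> s \<Longrightarrow> separated (Y \<times> {s..s'}) (Y' \<times> {p..p'})"
  unfolding separated_def
  by (rule disjI1, rule exI[of _ s], force, rule disjI1, rule exI[of _ s], force,
      rule disjI2, rule exI[of _ s], force, rule disjI2, rule exI[of _ s], force)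

lemma pairwise_separated_insert:
  "(\<And>K'. K' \<in> R \<Longrightarrow> separated K K' \<and> separated K' K) \<Longrightarrow> pairwise separated R
    \<Longrightarrow> pairwise separated (insert K R)"
  by (auto simp: pairwise_insert)

lemma negligible_chart_separated:
  assumes ax: "axes u w" and s: "separated K K'"
  shows "negligible (chart c u w ` K \<inter> chart c u w ` K')"
proof -
  have i: "chart c u w ` K \<inter> chart c u w ` K' = chart c u w ` (K \<inter> K')"
    using inj_chart[OF ax] by (simp add: image_Int)
  have line: "negligible {z. coord c a z = s}" if "a \<noteq> 0" for a s
  proof -
    have "{z. coord c a z = s} = {z. a \<bullet> z = s * (a \<bullet> a) + a \<bullet> c}"
      using that by (auto simp: coord_def field_simps inner_diff_left inner_diff_right inner_commute)
    then show ?thesis using negligible_hyperplane[of a] that by simp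
  qed
  from s show ?thesis
    unfolding separated_def
  proof (elim disjE exE)
    fix s assume "K \<inter> K' \<subseteq> {z. fst z = s}"
    then have "coord c u (chart c u w z) = s" if "z \<in> K \<inter> K'" for z
      using coord_chart[OF ax] that by blast
    then have sub: "chart c u w ` (K \<inter> K') \<subseteq> {z. coord c u z = s}" by blast
    have "u \<noteq> 0" using ax by (simp add: axes_def)
    then show ?thesis unfolding i by (rule negligible_subset[OF line sub])
  next
    fix s assume "K \<inter> K' \<subseteq> {z. snd z = s}"
    then have "coord c w (chart c u w z) = s" if "z \<in> K \<inter> K'" for z
      using coord_chart[OF ax] that by blast
    then have sub: "chart c u w ` (K \<inter> K') \<subseteq> {z. coord c w z = s}" by blast
    have "w \<noteq> 0" using ax by (simp add: axes_def)
    then show ?thesis unfolding i by (rule negligible_subset[OF line sub])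
  qed
qed

definition rectangle :: "point set \<Rightarrow> bool" where
  "rectangle K \<longleftrightarrow> (\<exists>p p' r r'. p < p' \<and> r < r' \<and> K = {p..p'} \<times> {r..r'})"

lemma rectangleI: "p < p' \<Longrightarrow> r < r' \<Longrightarrow> rectangle ({p..p'} \<times> {r..r'})"
  unfolding rectangle_def
  by (rule exI[of _ p], rule exI[of _ p'], rule exI[of _ r], rule exI[of _ r']) simp

lemma tiling_chart:
  assumes ax: "axes u w" and R: "finite R" "\<forall>K\<in>R. rectangle K"
    and sep: "pairwise separated R"
  shows "tiling (chart c u w ` \<Union>R) ((`) (chart c u w) ` R)"
  unfolding tiling_def
proof (intro conjI ballI)
  fix K assume "K \<in> (`) (chart c u w) ` R"
  then obtain K' where "K = chart c u w ` K'" "rectangle K'" using R(2) by auto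
  then obtain p p' r r' where "p < p'" "r < r'" "K = chart c u w ` ({p..p'} \<times> {r..r'})"
    unfolding rectangle_def by auto
  then show "\<exists>c u w. axes u w \<and> K = tile c u w"
    using chart_rectangle[of p p' r r' c u w] axes_scale[OF ax, of "p' - p" "r' - r"]
    by (intro exI[of _ "chart c u w (p, r)"] exI[of _ "(p' - p) *\<^sub>R u"] exI[of _ "(r' - r) *\<^sub>R w"]) simp
next
  show "pairwise (\<lambda>K K'. negligible (K \<inter> K')) ((`) (chart c u w) ` R)"
  proof (rule pairwiseI)
    fix X Y assume XY: "X \<in> (`) (chart c u w) ` R" "Y \<in> (`) (chart c u w) ` R" "X \<noteq> Y"
    then obtain K K' where K: "K \<in> R" "X = chart c u w ` K" "K' \<in> R" "Y = chart c u w ` K'" by blast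
    then have "separated K K'" using sep XY(3) by (auto dest: pairwiseD)
    then show "negligible (X \<inter> Y)" using negligible_chart_separated[OF ax] K by simp
  qed
qed (use R in auto)

text \<open>
  A hypothetical pressure that violates the inf-sup condition with every constant above \<open>\<beta>\<close>, on a patch
  described in the coordinates of one chart. The estimates below say that its vertex differences are small.
\<close>

locale weak_pressure =
  fixes c u w :: point and \<omega> :: "point set" and P :: "point set set" and q :: "point \<Rightarrow> real" and \<beta> \<rho> :: real
  assumes til: "tiling \<omega> P" and ax: "axes u w"
    and q: "q \<in> pressure_space \<omega> P" and pos: "L2_norm_on \<omega> q > 0" and below: "inf_sup_below \<beta> \<omega> P q"
    and \<beta>: "\<beta> > 0"
begin

definition "cell p p' r r' = chart c u w ` ({p..p'} \<times> {r..r'})"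
definition "Q x y = q (chart c u w (x, y))"
text \<open>
  The bound of the single test estimates. The factor \<open>|u| |w|\<close> is divided out because areas are measured in
  chart coordinates below.
\<close>

definition "\<epsilon> = 144\<^sup>2 * (8 * \<rho>\<^sup>2 + 1) * (\<beta> * L2_norm_on \<omega> q)\<^sup>2 / (norm u * norm w)"

lemma area_pos: "norm u * norm w > 0"
  using ax by (simp add: axes_def)

lemma eps_nonneg: "\<epsilon> \<ge> 0"
  using area_pos by (auto simp: \<epsilon>_def intro!: divide_nonneg_nonneg mult_nonneg_nonneg)

lemma chart_step: "chart c u w (x, y) + s *\<^sub>R u = chart c u w (x + s, y)"
  "chart c u w (x, y) + s *\<^sub>R w = chart c u w (x, y + s)"
  "chart c u w (x, y) - s *\<^sub>R u = chart c u w (x - s, y)"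
  by (auto simp: chart_def algebra_simps)

lemma vertical_difference:
  assumes "cell (x - a) x r r' \<in> P" "cell x (x + a) r r' \<in> P" "0 < a" "r < r'"
    and \<rho>: "(r' - r) * norm w \<le> \<rho> * (a * norm u)" and y: "y \<in> {x - a, x, x + a}"
  shows "a * (r' - r) * (Q y r' - Q y r)\<^sup>2 \<le> \<epsilon>"
proof -
  let ?c = "chart c u w (x, r)"
  have ax': "axes (a *\<^sub>R u) ((r' - r) *\<^sub>R w)" using ax assms by (intro axes_scale) auto
  have R: "tile ?c (a *\<^sub>R u) ((r' - r) *\<^sub>R w) \<in> P"
    using assms chart_rectangle[of x "x + a" r r' c u w] by (simp add: cell_def)
  have "tile ?c (- (a *\<^sub>R u)) ((r' - r) *\<^sub>R w) = tile (chart c u w (x - a, r)) (a *\<^sub>R u) ((r' - r) *\<^sub>R w)"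
    using tile_reflect[of "chart c u w (x - a, r)" "a *\<^sub>R u"] by (simp add: chart_step)
  then have L: "tile ?c (- (a *\<^sub>R u)) ((r' - r) *\<^sub>R w) \<in> P"
    using assms chart_rectangle[of "x - a" x r r' c u w] by (simp add: cell_def)
  have \<rho>': "norm ((r' - r) *\<^sub>R w) \<le> \<rho> * norm (a *\<^sub>R u)" using \<rho> assms by simp
  have "norm (a *\<^sub>R u) * norm ((r' - r) *\<^sub>R w) * ((Q x r' - Q x r)\<^sup>2 + (Q (x + a) r' - Q (x + a) r)\<^sup>2 + (Q (x - a) r' - Q (x - a) r)\<^sup>2)
     \<le> 144\<^sup>2 * (8 * \<rho>\<^sup>2 + 1) * (\<beta> * L2_norm_on \<omega> q)\<^sup>2"
    using strip_estimate[OF til ax' R L \<rho>' q pos below \<beta>] by (simp add: chart_step Q_def)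
  then have "(norm u * norm w) * (a * (r' - r) * ((Q x r' - Q x r)\<^sup>2 + (Q (x + a) r' - Q (x + a) r)\<^sup>2 + (Q (x - a) r' - Q (x - a) r)\<^sup>2))
     \<le> (norm u * norm w) * \<epsilon>"
    using assms area_pos by (simp add: \<epsilon>_def mult_ac)
  then have "a * (r' - r) * ((Q x r' - Q x r)\<^sup>2 + (Q (x + a) r' - Q (x + a) r)\<^sup>2 + (Q (x - a) r' - Q (x - a) r)\<^sup>2) \<le> \<epsilon>"
    by (rule mult_left_le_imp_le[OF _ area_pos])
  moreover have "a * (r' - r) * (Q y r' - Q y r)\<^sup>2
      \<le> a * (r' - r) * ((Q x r' - Q x r)\<^sup>2 + (Q (x + a) r' - Q (x + a) r)\<^sup>2 + (Q (x - a) r' - Q (x - a) r)\<^sup>2)"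
    using y assms by (intro mult_left_mono) auto
  ultimately show ?thesis by linarith
qed

text \<open>
  The two edge vectors change roles here: the bubble points along the row, so its admissible aspect ratio
  bounds length by height.
\<close>

lemma mean_horizontal_difference:
  assumes K: "cell p p' r r' \<in> P" and "p < p'" "r < r'" and \<rho>: "(p' - p) * norm u \<le> \<rho> * ((r' - r) * norm w)"
  shows "(p' - p) * (r' - r) * ((Q p' r - Q p r) + (Q p' r' - Q p r'))\<^sup>2 \<le> \<epsilon>"
proof -
  let ?c = "chart c u w (p, r)"
  have ax': "axes ((r' - r) *\<^sub>R w) ((p' - p) *\<^sub>R u)" using axes_commute[OF ax] assms by (intro axes_scale) auto
  have R: "tile ?c ((r' - r) *\<^sub>R w) ((p' - p) *\<^sub>R u) \<in> P"
    using assms chart_rectangle[of p p' r r' c u w] by (simp add: cell_def tile_commute)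
  have \<rho>': "norm ((p' - p) *\<^sub>R u) \<le> \<rho> * norm ((r' - r) *\<^sub>R w)" using \<rho> assms by simp
  have "norm ((r' - r) *\<^sub>R w) * norm ((p' - p) *\<^sub>R u) * ((Q p' r - Q p r) + (Q p' r' - Q p r'))\<^sup>2
     \<le> 144\<^sup>2 * (8 * \<rho>\<^sup>2 + 1) * (\<beta> * L2_norm_on \<omega> q)\<^sup>2"
    using cell_estimate[OF til ax' R \<rho>' q pos below \<beta>] by (simp add: chart_step Q_def)
  then have "(norm u * norm w) * ((p' - p) * (r' - r) * ((Q p' r - Q p r) + (Q p' r' - Q p r'))\<^sup>2)
     \<le> (norm u * norm w) * \<epsilon>"
    using assms area_pos by (simp add: \<epsilon>_def mult_ac)
  then show ?thesis by (rule mult_left_le_imp_le[OF _ area_pos])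
qed

lemma norm_le_corners:
  assumes M: "\<And>K. K \<in> P \<Longrightarrow> \<exists>p p' r r'. p < p' \<and> r < r' \<and> K = cell p p' r r'
      \<and> (\<forall>x\<in>{p, p'}. \<forall>y\<in>{r, r'}. (p' - p) * (r' - r) * (Q x y - k)\<^sup>2 \<le> M)"
  shows "(L2_norm_on \<omega> q)\<^sup>2 \<le> real (card P) * (4 * M * (norm u * norm w))"
proof -
  have "integral K (\<lambda>z. (q z - k)\<^sup>2) \<le> 4 * M * (norm u * norm w)" if KP: "K \<in> P" for K
  proof -
    obtain p p' r r' where pr: "p < p'" "r < r'" and K: "K = cell p p' r r'"
      and c: "\<And>x y. x \<in> {p, p'} \<Longrightarrow> y \<in> {r, r'} \<Longrightarrow> (p' - p) * (r' - r) * (Q x y - k)\<^sup>2 \<le> M"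
      using M[OF KP] by metis
    let ?c = "chart c u w (p, r)"
    have ax': "axes ((p' - p) *\<^sub>R u) ((r' - r) *\<^sub>R w)" using ax pr by (intro axes_scale) auto
    have K': "K = tile ?c ((p' - p) *\<^sub>R u) ((r' - r) *\<^sub>R w)"
      using pr chart_rectangle[of p p' r r' c u w] by (simp add: K cell_def)
    have qK: "q \<in> Q_space 1 K" "continuous_on K q"
      using q KP continuous_on_subset tiling_subset[OF til KP] by (auto simp: pressure_space_def)
    have "integral K (\<lambda>z. (q z - k)\<^sup>2)
      \<le> norm ((p' - p) *\<^sub>R u) * norm ((r' - r) *\<^sub>R w) * ((Q p r - k)\<^sup>2 + (Q p' r - k)\<^sup>2 + (Q p r' - k)\<^sup>2 + (Q p' r' - k)\<^sup>2)"
      using integral_square_le_corners[OF ax' qK[unfolded K'], of k] by (simp add: K' chart_step Q_def)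
    also have "\<dots> = (norm u * norm w) * ((p' - p) * (r' - r) * (Q p r - k)\<^sup>2 + (p' - p) * (r' - r) * (Q p' r - k)\<^sup>2
        + (p' - p) * (r' - r) * (Q p r' - k)\<^sup>2 + (p' - p) * (r' - r) * (Q p' r' - k)\<^sup>2)"
      using pr by (simp add: distrib_left mult_ac)
    also have "\<dots> \<le> (norm u * norm w) * (M + M + M + M)"
      by (intro mult_left_mono add_mono c) auto
    finally show ?thesis by (simp add: mult_ac)
  qed
  then have "(\<Sum>K\<in>P. integral K (\<lambda>z. (q z - k)\<^sup>2)) \<le> real (card P) * (4 * M * (norm u * norm w))"
    by (rule sum_bounded_above)
  with pressure_norm_le_deviation[OF til q, of k] show ?thesis by linarith
qed

end

text \<open>
  The row estimate for columns: exchange the two edge vectors of the chart.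
\<close>

lemma (in weak_pressure) horizontal_difference:
  assumes "cell p p' (y - a) y \<in> P" "cell p p' y (y + a) \<in> P" "0 < a" "p < p'"
    and "(p' - p) * norm u \<le> \<rho> * (a * norm w)" and "x \<in> {y - a, y, y + a}"
  shows "a * (p' - p) * (Q p' x - Q p x)\<^sup>2 \<le> \<epsilon>"
proof -
  interpret swap: weak_pressure c w u \<omega> P q \<beta> \<rho>
    using til axes_commute[OF ax] q pos below \<beta> by unfold_locales
  have c: "chart c w u (s, r) = chart c u w (r, s)" for r s by (simp add: chart_def)
  have cells: "swap.cell r r' s s' = cell s s' r r'" for r r' s s'
  proof -
    have "{r..r'} \<times> {s..s'} = prod.swap ` ({s..s'} \<times> {r..r'})" by auto
    then show ?thesis
      unfolding swap.cell_def cell_def by (simp add: image_image c case_prod_unfold prod.swap_def)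
  qed
  have "a * (p' - p) * (swap.Q x p' - swap.Q x p)\<^sup>2 \<le> swap.\<epsilon>"
    by (rule swap.vertical_difference[where x = y]) (use assms in \<open>simp_all only: cells\<close>)
  moreover have "swap.\<epsilon> = \<epsilon>" by (simp only: swap.\<epsilon>_def \<epsilon>_def mult.commute)
  ultimately show ?thesis by (simp add: swap.Q_def Q_def c)
qed

section \<open>The three patch types\<close>

lemma weighted_square_add:
  fixes a b :: real
  assumes "0 \<le> A" "A * a\<^sup>2 \<le> \<alpha>" "A * b\<^sup>2 \<le> \<gamma>"
  shows "A * (a + b)\<^sup>2 \<le> 2 * (\<alpha> + \<gamma>)"
proof -
  have "(a + b)\<^sup>2 \<le> 2 * a\<^sup>2 + 2 * b\<^sup>2"
    using zero_le_power2[of "a - b"] by (simp add: power2_eq_square algebra_simps)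
  then have "A * (a + b)\<^sup>2 \<le> A * (2 * a\<^sup>2 + 2 * b\<^sup>2)" using assms(1) by (rule mult_left_mono)
  with assms(2,3) show ?thesis by (simp add: algebra_simps)
qed

context weak_pressure
begin

definition corner_bounded :: "real \<Rightarrow> real \<Rightarrow> real \<Rightarrow> real \<Rightarrow> real \<Rightarrow> real \<Rightarrow> bool" where
  "corner_bounded k M p p' r r' \<longleftrightarrow> p < p' \<and> r < r'
     \<and> (\<forall>x\<in>{p, p'}. \<forall>y\<in>{r, r'}. (p' - p) * (r' - r) * (Q x y - k)\<^sup>2 \<le> M)"

lemma norm_le_corner_bounded:
  assumes P: "P = (\<lambda>(p, p', r, r'). cell p p' r r') ` I"
    and I: "\<And>p p' r r'. (p, p', r, r') \<in> I \<Longrightarrow> corner_bounded k M p p' r r'"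
  shows "(L2_norm_on \<omega> q)\<^sup>2 \<le> real (card P) * (4 * M * (norm u * norm w))"
proof (rule norm_le_corners[where k = k])
  fix K assume "K \<in> P"
  then obtain p p' r r' where "(p, p', r, r') \<in> I" "K = cell p p' r r'" unfolding P by auto
  with I show "\<exists>p p' r r'. p < p' \<and> r < r' \<and> K = cell p p' r r'
      \<and> (\<forall>x\<in>{p, p'}. \<forall>y\<in>{r, r'}. (p' - p) * (r' - r) * (Q x y - k)\<^sup>2 \<le> M)"
    unfolding corner_bounded_def by metis
qed

lemma corner_boundedI:
  assumes "p < p'" "r < r'" "(p' - p) * (r' - r) = A"
    and "\<And>x. x \<in> {p, p'} \<Longrightarrow> A * (Q x r - k)\<^sup>2 \<le> M" "\<And>x. x \<in> {p, p'} \<Longrightarrow> A * (Q x r' - k)\<^sup>2 \<le> M"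
  shows "corner_bounded k M p p' r r'"
  unfolding corner_bounded_def assms(3) using assms(1,2,4,5) by blast

text \<open>
  One edge across a thin layer carries the bound from the upper vertex to the lower one.
\<close>

lemma layer_step:
  assumes "0 \<le> A" "A * (Q x r' - k)\<^sup>2 \<le> \<alpha>" "A * (Q x r' - Q x r)\<^sup>2 \<le> \<epsilon>"
  shows "A * (Q x r - k)\<^sup>2 \<le> 2 * (\<alpha> + \<epsilon>)"
proof -
  have "A * (Q x r - Q x r')\<^sup>2 \<le> \<epsilon>" using assms(3) by (simp add: power2_commute)
  from weighted_square_add[OF assms(1,2) this] show ?thesis by simp
qed

text \<open>
  The shape regular part in types (d) and (e). Its cells lie in one row, so the row estimate gives only
  the differences across it. The bubble of a cell gives the sum of the two differences along the row, and these
  two differ by a combination of the differences across it.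
\<close>

lemma two_cell_block:
  assumes "cell (- H) 0 h (h + L) \<in> P" "cell 0 H h (h + L) \<in> P" and H: "0 < H" and L: "0 < L"
    and uw: "norm u = 1" "norm w = 1" and \<rho>: "L \<le> \<rho> * H" "H \<le> \<rho> * L"
    and x: "x \<in> {- H, 0, H}"
  shows "H * L * (Q x h - Q 0 h)\<^sup>2 \<le> 3 * \<epsilon>" "H * L * (Q x (h + L) - Q 0 h)\<^sup>2 \<le> 8 * \<epsilon>"
proof -
  have A: "0 \<le> H * L" using H L by simp
  have v: "H * L * (Q x (h + L) - Q x h)\<^sup>2 \<le> \<epsilon>" if "x \<in> {- H, 0, H}" for x
    using vertical_difference[of 0 H h "h + L" x] assms that by auto
  have gp: "H * L * ((Q H h - Q 0 h) + (Q H (h + L) - Q 0 (h + L)))\<^sup>2 \<le> \<epsilon>"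
    using mean_horizontal_difference[of 0 H h "h + L"] assms by simp
  have gm: "H * L * ((Q 0 h - Q (- H) h) + (Q 0 (h + L) - Q (- H) (h + L)))\<^sup>2 \<le> \<epsilon>"
    using mean_horizontal_difference[of "- H" 0 h "h + L"] assms by simp
  \<comment> \<open>half of a sum of three terms that are bounded by \<open>\<epsilon>\<close>; the constant 3 is rounded up from 5/2\<close>
  have third: "H * L * d\<^sup>2 \<le> 3 * \<epsilon>" if "2 * d = g + (a - b)" "H * L * g\<^sup>2 \<le> \<epsilon>" "H * L * a\<^sup>2 \<le> \<epsilon>" "H * L * b\<^sup>2 \<le> \<epsilon>"
    for d g a b
  proof -
    have "H * L * (g + (a + - b))\<^sup>2 \<le> 2 * (\<epsilon> + 2 * (\<epsilon> + \<epsilon>))"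
      using that by (intro weighted_square_add A) auto
    then have "H * L * (2 * d)\<^sup>2 \<le> 10 * \<epsilon>" using that(1) by simp
    then show ?thesis using eps_nonneg by (simp add: power_mult_distrib)
  qed
  show 3: "H * L * (Q x h - Q 0 h)\<^sup>2 \<le> 3 * \<epsilon>"
  proof (cases "x = H")
    case True
    show ?thesis
      by (rule third[OF _ gp v[of 0] v[of H]]) (use True in auto)
  next
    case False
    show ?thesis
    proof (cases "x = 0")
      case True
      then show ?thesis using eps_nonneg by simp
    next
      case False
      then have "x = - H" using x \<open>x \<noteq> H\<close> by auto
      moreover have "H * L * (Q 0 h - Q (- H) h)\<^sup>2 \<le> 3 * \<epsilon>"
        by (rule third[OF _ gm v[of "- H"] v[of 0]]) auto
      ultimately show ?thesis by (simp add: power2_commute)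
    qed
  qed
  show "H * L * (Q x (h + L) - Q 0 h)\<^sup>2 \<le> 8 * \<epsilon>"
    using weighted_square_add[OF A v[OF x] 3] by simp
qed

text \<open>
  A bound weighted with the area \<open>A\<close> of a shape regular cell passes to the area \<open>B\<close> of a thin cell.
\<close>

lemma weaken_area:
  assumes "0 \<le> B" "B \<le> 2 * \<sigma> * A" "A * z\<^sup>2 \<le> 3 * \<epsilon>" "\<sigma> \<ge> (1::real)"
  shows "B * z\<^sup>2 \<le> 6 * \<sigma> * \<epsilon>"
proof -
  have "B * z\<^sup>2 \<le> (2 * \<sigma>) * (A * z\<^sup>2)"
    using mult_right_mono[OF assms(2), of "z\<^sup>2"] by (simp add: mult_ac)
  also have "\<dots> \<le> (2 * \<sigma>) * (3 * \<epsilon>)" using assms by (intro mult_left_mono) auto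
  finally show ?thesis by simp
qed

lemma eps_le: "\<sigma> \<ge> 1 \<Longrightarrow> \<epsilon> \<le> \<sigma> * \<epsilon>"
  using eps_nonneg mult_right_mono[of 1 \<sigma> \<epsilon>] by simp

lemma norm_bound_d:
  assumes \<sigma>: "\<sigma> \<ge> 1" "\<rho> = 2 * \<sigma>" and uw: "norm u = 1" "norm w = 1"
    and h: "0 < h" "h \<le> H" and L: "H \<le> \<sigma> * L" "L \<le> \<sigma> * H"
    and P: "P = {cell (- H) 0 (- h) h, cell 0 H (- h) h, cell (- H) 0 h (h + L), cell 0 H h (h + L)}"
  shows "(L2_norm_on \<omega> q)\<^sup>2 \<le> real (card P) * (4 * (30 * \<sigma> * \<epsilon>) * (norm u * norm w))"
proof -
  have H: "0 < H" using h by simp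
  then have "0 < \<sigma> * L" using L by simp
  then have Lpos: "0 < L" using \<sigma> by (simp add: zero_less_mult_iff)
  have \<rho>: "L \<le> \<rho> * H" "H \<le> \<rho> * L" using L H Lpos unfolding \<sigma>(2) by linarith+
  note b = two_cell_block[OF _ _ H Lpos uw \<rho>, of h]
  have top: "H * L * (Q x h - Q 0 h)\<^sup>2 \<le> 3 * \<epsilon>" "H * L * (Q x (h + L) - Q 0 h)\<^sup>2 \<le> 8 * \<epsilon>"
    if "x \<in> {- H, 0, H}" for x using b that P by auto
  have "H * (2 * h) \<le> H * (2 * (\<sigma> * L))" using h H L by (intro mult_left_mono) auto
  then have area: "H * (2 * h) \<le> 2 * \<sigma> * (H * L)" by (simp add: mult_ac)
  have thin: "H * (2 * h) * (Q x h - Q 0 h)\<^sup>2 \<le> 6 * \<sigma> * \<epsilon>" if "x \<in> {- H, 0, H}" for x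
    using weaken_area[OF _ area top(1)[OF that]] H h \<sigma> by simp
  have "1 * H \<le> \<sigma> * H" using H \<sigma>(1) by (intro mult_right_mono) auto
  then have "2 * h \<le> 2 * \<sigma> * H" using h by linarith
  then have "H * (2 * h) * (Q x h - Q x (- h))\<^sup>2 \<le> \<epsilon>" if "x \<in> {- H, 0, H}" for x
    using vertical_difference[of 0 H "- h" h x] P that H h uw \<sigma> by simp
  then have bot: "H * (2 * h) * (Q x (- h) - Q 0 h)\<^sup>2 \<le> 2 * (6 * \<sigma> * \<epsilon> + \<epsilon>)" if "x \<in> {- H, 0, H}" for x
    using layer_step[OF _ thin] that H h by simp
  let ?I = "{(- H, 0, - h, h), (0, H, - h, h), (- H, 0, h, h + L), (0, H, h, h + L)}"
  let ?M = "30 * \<sigma> * \<epsilon>"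
  have M: "3 * \<epsilon> \<le> ?M" "8 * \<epsilon> \<le> ?M" "6 * \<sigma> * \<epsilon> \<le> ?M" "2 * (6 * \<sigma> * \<epsilon> + \<epsilon>) \<le> ?M"
    using eps_le[OF \<sigma>(1)] eps_nonneg \<sigma> by auto
  have "corner_bounded (Q 0 h) ?M (- H) 0 h (h + L)"
    by (rule corner_boundedI[OF _ _ _ order_trans[OF top(1) M(1)] order_trans[OF top(2) M(2)]]) (use H Lpos in auto)
  moreover have "corner_bounded (Q 0 h) ?M 0 H h (h + L)"
    by (rule corner_boundedI[OF _ _ _ order_trans[OF top(1) M(1)] order_trans[OF top(2) M(2)]]) (use H Lpos in auto)
  moreover have "corner_bounded (Q 0 h) ?M (- H) 0 (- h) h"
    by (rule corner_boundedI[OF _ _ _ order_trans[OF bot M(4)] order_trans[OF thin M(3)]]) (use H h in auto)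
  moreover have "corner_bounded (Q 0 h) ?M 0 H (- h) h"
    by (rule corner_boundedI[OF _ _ _ order_trans[OF bot M(4)] order_trans[OF thin M(3)]]) (use H h in auto)
  ultimately have good: "corner_bounded (Q 0 h) ?M p p' r r'" if "(p, p', r, r') \<in> ?I" for p p' r r'
    using that by (elim insertE emptyE) (simp_all only: prod.inject)
  show ?thesis by (rule norm_le_corner_bounded[of ?I]) (simp add: P, rule good)
qed

lemma norm_bound_e:
  assumes \<sigma>: "\<sigma> \<ge> 1" "\<rho> = 2 * \<sigma>" and uw: "norm u = 1" "norm w = 1"
    and h: "0 < h" "h \<le> H" and L: "H \<le> \<sigma> * L" "L \<le> \<sigma> * H"
    and P: "P = {cell (- H) 0 (- h) 0, cell 0 H (- h) 0, cell (- H) 0 0 h, cell 0 H 0 h,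
                 cell (- H) 0 h (h + L), cell 0 H h (h + L)}"
  shows "(L2_norm_on \<omega> q)\<^sup>2 \<le> real (card P) * (4 * (30 * \<sigma> * \<epsilon>) * (norm u * norm w))"
proof -
  have H: "0 < H" using h by simp
  then have "0 < \<sigma> * L" using L by simp
  then have Lpos: "0 < L" using \<sigma> by (simp add: zero_less_mult_iff)
  have \<rho>: "L \<le> \<rho> * H" "H \<le> \<rho> * L" using L H Lpos unfolding \<sigma>(2) by linarith+
  note b = two_cell_block[OF _ _ H Lpos uw \<rho>, of h]
  have top: "H * L * (Q x h - Q 0 h)\<^sup>2 \<le> 3 * \<epsilon>" "H * L * (Q x (h + L) - Q 0 h)\<^sup>2 \<le> 8 * \<epsilon>"
    if "x \<in> {- H, 0, H}" for x using b that P by auto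
  have "H * h \<le> H * (2 * (\<sigma> * L))" using h H L by (intro mult_left_mono) auto
  then have area: "H * h \<le> 2 * \<sigma> * (H * L)" by (simp add: mult_ac)
  have thin: "H * h * (Q x h - Q 0 h)\<^sup>2 \<le> 6 * \<sigma> * \<epsilon>" if "x \<in> {- H, 0, H}" for x
    using weaken_area[OF _ area top(1)[OF that]] H h \<sigma> by simp
  have "1 * H \<le> \<sigma> * H" using H \<sigma>(1) by (intro mult_right_mono) auto
  then have thick: "h \<le> 2 * \<sigma> * H" using h H by linarith
  then have "H * h * (Q x h - Q x 0)\<^sup>2 \<le> \<epsilon>" if "x \<in> {- H, 0, H}" for x
    using vertical_difference[of 0 H 0 h x] P that H h uw \<sigma> by simp
  then have mid: "H * h * (Q x 0 - Q 0 h)\<^sup>2 \<le> 2 * (6 * \<sigma> * \<epsilon> + \<epsilon>)" if "x \<in> {- H, 0, H}" for x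
    using layer_step[OF _ thin] that H h by simp
  have "H * h * (Q x 0 - Q x (- h))\<^sup>2 \<le> \<epsilon>" if "x \<in> {- H, 0, H}" for x
    using vertical_difference[of 0 H "- h" 0 x] P that H h uw \<sigma> thick by simp
  then have bot: "H * h * (Q x (- h) - Q 0 h)\<^sup>2 \<le> 2 * (2 * (6 * \<sigma> * \<epsilon> + \<epsilon>) + \<epsilon>)" if "x \<in> {- H, 0, H}" for x
    using layer_step[OF _ mid] that H h by simp
  let ?I = "{(- H, 0, - h, 0), (0, H, - h, 0), (- H, 0, 0, h), (0, H, 0, h), (- H, 0, h, h + L), (0, H, h, h + L)}"
  \<comment> \<open>the constant 30 is set by the lowest vertices, where \<open>2 * (2 * (6 * \<sigma> + 1) + 1)\<close> is at most \<open>30 * \<sigma>\<close>\<close>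
  let ?M = "30 * \<sigma> * \<epsilon>"
  have M: "3 * \<epsilon> \<le> ?M" "8 * \<epsilon> \<le> ?M" "6 * \<sigma> * \<epsilon> \<le> ?M" "2 * (6 * \<sigma> * \<epsilon> + \<epsilon>) \<le> ?M"
    "2 * (2 * (6 * \<sigma> * \<epsilon> + \<epsilon>) + \<epsilon>) \<le> ?M"
    using eps_le[OF \<sigma>(1)] eps_nonneg \<sigma> by auto
  have "corner_bounded (Q 0 h) ?M (- H) 0 h (h + L)"
    by (rule corner_boundedI[OF _ _ _ order_trans[OF top(1) M(1)] order_trans[OF top(2) M(2)]]) (use H Lpos in auto)
  moreover have "corner_bounded (Q 0 h) ?M 0 H h (h + L)"
    by (rule corner_boundedI[OF _ _ _ order_trans[OF top(1) M(1)] order_trans[OF top(2) M(2)]]) (use H Lpos in auto)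
  moreover have "corner_bounded (Q 0 h) ?M (- H) 0 0 h"
    by (rule corner_boundedI[OF _ _ _ order_trans[OF mid M(4)] order_trans[OF thin M(3)]]) (use H h in auto)
  moreover have "corner_bounded (Q 0 h) ?M 0 H 0 h"
    by (rule corner_boundedI[OF _ _ _ order_trans[OF mid M(4)] order_trans[OF thin M(3)]]) (use H h in auto)
  moreover have "corner_bounded (Q 0 h) ?M (- H) 0 (- h) 0"
    by (rule corner_boundedI[OF _ _ _ order_trans[OF bot M(5)] order_trans[OF mid M(4)]]) (use H h in auto)
  moreover have "corner_bounded (Q 0 h) ?M 0 H (- h) 0"
    by (rule corner_boundedI[OF _ _ _ order_trans[OF bot M(5)] order_trans[OF mid M(4)]]) (use H h in auto)
  ultimately have good: "corner_bounded (Q 0 h) ?M p p' r r'" if "(p, p', r, r') \<in> ?I" for p p' r r'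
    using that by (elim insertE emptyE) (simp_all only: prod.inject)
  show ?thesis by (rule norm_le_corner_bounded[of ?I]) (simp add: P, rule good)
qed

text \<open>
  In type (f) the shape regular part has two rows and two columns, and each thin part is a further row or
  column. Every row and every column consists of two cells of equal length, so row and column estimates give
  all differences across them. The reference vertex is the centre of the shape regular part.
\<close>

lemma norm_bound_f:
  assumes \<sigma>: "\<sigma> \<ge> 1" "\<rho> = 2 * \<sigma>" and uw: "norm u \<le> \<sigma> * norm w" "norm w \<le> \<sigma> * norm u"
    and t: "0 < t" "t \<le> 1 / 2" and m: "m = (1 + t) / 2"
    and P: "P = {cell t m 0 t, cell m 1 0 t, cell 0 t t m, cell 0 t m 1,
                 cell t m t m, cell m 1 t m, cell t m m 1, cell m 1 m 1}"
  shows "(L2_norm_on \<omega> q)\<^sup>2 \<le> real (card P) * (4 * (30 * \<sigma> * \<epsilon>) * (norm u * norm w))"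
proof -
  define a where "a = (1 - t) / 2"
  have a: "0 < a" "m - a = t" "m + a = 1" "m - t = a" "1 - m = a" "t \<le> 2 * a"
    using t by (auto simp: a_def m field_simps)
  have tm: "t < m" "m < 1" using a by auto
  have thick: "d * norm w \<le> \<rho> * (a * norm u)" "d * norm u \<le> \<rho> * (a * norm w)" if "0 \<le> d" "d \<le> 2 * a" for d
  proof -
    have "d * norm w \<le> (2 * a) * (\<sigma> * norm u)" "d * norm u \<le> (2 * a) * (\<sigma> * norm w)"
      using that a uw by (intro mult_mono; simp)+
    then show "d * norm w \<le> \<rho> * (a * norm u)" "d * norm u \<le> \<rho> * (a * norm w)"
      by (simp_all add: \<sigma> mult_ac)
  qed
  have v: "a * (r' - r) * (Q x r' - Q x r)\<^sup>2 \<le> \<epsilon>"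
    if xy: "x \<in> {t, m, 1}" and r: "(r, r') \<in> {(0, t), (t, m), (m, 1)}" for x r r'
  proof -
    consider "r = 0" "r' = t" | "r = t" "r' = m" | "r = m" "r' = 1" using r by auto
    then show ?thesis
    proof cases
      case 1
      then show ?thesis using vertical_difference[of m a 0 t x] thick[of t] xy t by (simp add: a P)
    next
      case 2
      then show ?thesis using vertical_difference[of m a t m x] thick[of a] xy tm by (simp add: a P)
    next
      case 3
      then show ?thesis using vertical_difference[of m a m 1 x] thick[of a] xy tm by (simp add: a P)
    qed
  qed
  have g: "a * (r' - r) * (Q r' y - Q r y)\<^sup>2 \<le> \<epsilon>"
    if xy: "y \<in> {t, m, 1}" and r: "(r, r') \<in> {(0, t), (t, m), (m, 1)}" for y r r'
  proof -
    consider "r = 0" "r' = t" | "r = t" "r' = m" | "r = m" "r' = 1" using r by auto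
    then show ?thesis
    proof cases
      case 1
      then show ?thesis using horizontal_difference[of 0 t m a y] thick[of t] xy t by (simp add: a P)
    next
      case 2
      then show ?thesis using horizontal_difference[of t m m a y] thick[of a] xy tm by (simp add: a P)
    next
      case 3
      then show ?thesis using horizontal_difference[of m 1 m a y] thick[of a] xy tm by (simp add: a P)
    qed
  qed
  have A: "0 \<le> a * a" using a by simp
  have mid: "a * a * (Q x m - Q m m)\<^sup>2 \<le> \<epsilon>" if "x \<in> {t, m, 1}" for x
    using that g[of m t m] g[of m m 1] eps_nonneg by (auto simp: a power2_commute)
  have vert: "a * a * (Q x y - Q x m)\<^sup>2 \<le> \<epsilon>" if "x \<in> {t, m, 1}" "y \<in> {t, m, 1}" for x y
    using that(2) v[OF that(1), of t m] v[OF that(1), of m 1] eps_nonneg by (auto simp: a power2_commute)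
  have block: "a * a * (Q x y - Q m m)\<^sup>2 \<le> 4 * \<epsilon>" if "x \<in> {t, m, 1}" "y \<in> {t, m, 1}" for x y
    using weighted_square_add[OF A vert[OF that] mid[OF that(1)]] by simp
  have thin: "a * t * (Q x y - Q m m)\<^sup>2 \<le> 8 * \<epsilon>" if "x \<in> {t, m, 1}" "y \<in> {t, m, 1}" for x y
  proof -
    have "(a * t) * (Q x y - Q m m)\<^sup>2 \<le> (2 * (a * a)) * (Q x y - Q m m)\<^sup>2"
      using a t by (intro mult_right_mono) (auto simp: mult_left_mono)
    with block[OF that] show ?thesis by simp
  qed
  have B: "0 \<le> a * t" using a t by simp
  have low: "a * t * (Q x 0 - Q m m)\<^sup>2 \<le> 18 * \<epsilon>" if "x \<in> {t, m, 1}" for x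
    using layer_step[OF B thin[OF that, of t], of 0] v[OF that, of 0 t] by simp
  have leftmost: "a * t * (Q 0 y - Q m m)\<^sup>2 \<le> 18 * \<epsilon>" if "y \<in> {t, m, 1}" for y
  proof -
    have "a * t * (Q 0 y - Q t y)\<^sup>2 \<le> \<epsilon>" using g[OF that, of 0 t] by (simp add: power2_commute)
    from weighted_square_add[OF B this thin[of t y]] show ?thesis using that by simp
  qed
  let ?M = "30 * \<sigma> * \<epsilon>"
  have M: "4 * \<epsilon> \<le> ?M" "8 * \<epsilon> \<le> ?M" "18 * \<epsilon> \<le> ?M"
    using eps_le[OF \<sigma>(1)] eps_nonneg by auto
  have block_cell: "corner_bounded (Q m m) ?M p p' r r'" if "(p, p') \<in> {(t, m), (m, 1)}" "(r, r') \<in> {(t, m), (m, 1)}" for p p' r r'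
  proof -
    have "p' - p = a" "r' - r = a" "p < p'" "r < r'" using that a(4,5) tm by auto
    then show ?thesis
      by (intro corner_boundedI[OF _ _ _ order_trans[OF block M(1)] order_trans[OF block M(1)]]) (use that in auto)
  qed
  have row_cell: "corner_bounded (Q m m) ?M p p' 0 t" if "(p, p') \<in> {(t, m), (m, 1)}" for p p'
    by (rule corner_boundedI[OF _ _ _ order_trans[OF low M(3)] order_trans[OF thin M(2)]]) (use that tm a t in auto)
  have column_cell: "corner_bounded (Q m m) ?M 0 t r r'" if r: "(r, r') \<in> {(t, m), (m, 1)}" for r r'
  proof -
    have "a * t * (Q x y - Q m m)\<^sup>2 \<le> ?M" if "x \<in> {0, t}" "y \<in> {t, m, 1}" for x y
      using that order_trans[OF thin[of t y] M(2)] order_trans[OF leftmost[of y] M(3)] by auto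
    then show ?thesis by (intro corner_boundedI[of _ _ _ _ "a * t"]) (use r tm a t in auto)
  qed
  let ?I = "{(t, m, 0, t), (m, 1, 0, t), (0, t, t, m), (0, t, m, 1),
      (t, m, t, m), (m, 1, t, m), (t, m, m, 1), (m, 1, m, 1)}"
  have good: "corner_bounded (Q m m) ?M p p' r r'" if "(p, p', r, r') \<in> ?I" for p p' r r'
    using that by (elim insertE emptyE) (simp_all only: prod.inject, simp_all add: block_cell row_cell column_cell)
  show ?thesis by (rule norm_le_corner_bounded[of ?I]) (simp add: P, rule good)
qed

end

section \<open>Uniform inf-sup stability of edge patches\<close>

lemma rigid_motion_chart:
  assumes "coordinate_rigid_motion T"
  obtains c u w where "T = chart c u w" "axes u w" "norm u = 1" "norm w = 1"
proof -
  obtain f c where f: "orthogonal_transformation f" "f ` Basis \<subseteq> Basis \<union> uminus ` Basis" "T = (\<lambda>x. c + f x)"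
    using assms by (auto simp: coordinate_rigid_motion_def)
  define u where "u = f (1, 0)"
  define w where "w = f (0, 1)"
  have lin: "linear f" using f(1) by (rule orthogonal_transformation_linear)
  have "f z = fst z *\<^sub>R u + snd z *\<^sub>R w" for z
  proof -
    have "f (fst z *\<^sub>R (1, 0) + snd z *\<^sub>R (0, 1)) = fst z *\<^sub>R u + snd z *\<^sub>R w"
      unfolding u_def w_def by (simp only: linear_add[OF lin] linear_scale[OF lin])
    moreover have "fst z *\<^sub>R (1, 0) + snd z *\<^sub>R (0, 1) = z" by (simp add: prod_eq_iff)
    ultimately show ?thesis by (simp only:)
  qed
  then have "T = chart c u w" unfolding f(3) chart_def by (simp add: add.assoc)
  moreover have axis: "u \<in> {(1, 0), (0, 1), (-1, 0), (0, -1)}" "w \<in> {(1, 0), (0, 1), (-1, 0), (0, -1)}"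
    using f(2) unfolding u_def w_def Basis_point by auto
  moreover have "u \<bullet> w = 0"
    using f(1)[unfolded orthogonal_transformation_def, THEN conjunct2, rule_format, of "(1, 0)" "(0, 1)"]
    by (simp add: u_def w_def)
  then have "axes u w" using axis by (elim insertE emptyE) (simp_all add: axes_def zero_prod_def)
  moreover have "norm u = 1" "norm w = 1" using axis by (elim insertE emptyE; simp)+
  ultimately show ?thesis using that by blast
qed

text \<open>
  A patch has at most 8 cells, and each of them contributes at most four corner bounds.
\<close>

lemma (in weak_pressure) conclude_norm_bound:
  assumes L: "(L2_norm_on \<omega> q)\<^sup>2 \<le> real (card P) * (4 * (30 * \<sigma> * \<epsilon>) * (norm u * norm w))"
    and P: "card P \<le> 8" and \<sigma>: "\<sigma> \<ge> 1" "\<rho> = 2 * \<sigma>"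
  shows "1 \<le> 8 * 4 * 30 * 144\<^sup>2 * \<sigma> * (32 * \<sigma>\<^sup>2 + 1) * \<beta>\<^sup>2"
proof -
  let ?N = "8 * 4 * 30 * 144\<^sup>2 * \<sigma> * (32 * \<sigma>\<^sup>2 + 1)"
  have eps: "\<epsilon> * (norm u * norm w) = 144\<^sup>2 * (32 * \<sigma>\<^sup>2 + 1) * (\<beta>\<^sup>2 * (L2_norm_on \<omega> q)\<^sup>2)"
  proof -
    have "\<epsilon> * (norm u * norm w) = 144\<^sup>2 * (8 * \<rho>\<^sup>2 + 1) * (\<beta> * L2_norm_on \<omega> q)\<^sup>2"
      using ax by (simp add: \<epsilon>_def axes_def)
    also have "\<dots> = 144\<^sup>2 * (32 * \<sigma>\<^sup>2 + 1) * (\<beta>\<^sup>2 * (L2_norm_on \<omega> q)\<^sup>2)"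
      by (simp add: \<sigma>(2) power_mult_distrib)
    finally show ?thesis .
  qed
  have "(L2_norm_on \<omega> q)\<^sup>2 \<le> real (card P) * (4 * 30 * \<sigma> * (\<epsilon> * (norm u * norm w)))"
    using L by (simp add: mult_ac)
  also have "\<dots> \<le> 8 * (4 * 30 * \<sigma> * (\<epsilon> * (norm u * norm w)))"
    using P \<sigma> eps_nonneg by (intro mult_right_mono mult_nonneg_nonneg) auto
  also have "\<dots> = (?N * \<beta>\<^sup>2) * (L2_norm_on \<omega> q)\<^sup>2"
    unfolding eps by (simp add: mult_ac)
  finally have "1 * (L2_norm_on \<omega> q)\<^sup>2 \<le> (?N * \<beta>\<^sup>2) * (L2_norm_on \<omega> q)\<^sup>2" by simp
  then show ?thesis
    using pos by (intro mult_right_le_imp_le[of 1 "(L2_norm_on \<omega> q)\<^sup>2"]) auto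
qed

text \<open>
  A counterexample to all inf-sup constants above \<open>\<beta>\<close> forces \<open>\<beta>\<close> to be bounded below in terms of \<open>\<sigma>\<close>. In each case the
  rigid motion, and in type (f) the stretching too, is absorbed into the chart, and \<open>2 \<sigma>\<close> bounds the ratio of height
  to length for all rows and columns that occur, and the
  ratio of the edges for the cells on which a bubble is used.
\<close>

lemma weak_pressure_bound:
  assumes \<sigma>: "\<sigma> \<ge> 1" and patch: "edge_patch \<sigma> \<omega> P" and q: "q \<in> pressure_space \<omega> P" "x \<in> \<omega>" "q x \<noteq> 0"
    and \<beta>: "\<beta> > 0" and below: "inf_sup_below \<beta> \<omega> P q"
  shows "1 \<le> 8 * 4 * 30 * 144\<^sup>2 * \<sigma> * (32 * \<sigma>\<^sup>2 + 1) * \<beta>\<^sup>2"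
proof -
  obtain T \<omega>\<^sub>0 P\<^sub>0 where T: "coordinate_rigid_motion T"
    and p: "patch_d \<sigma> \<omega>\<^sub>0 P\<^sub>0 \<or> patch_e \<sigma> \<omega>\<^sub>0 P\<^sub>0 \<or> patch_f \<sigma> \<omega>\<^sub>0 P\<^sub>0"
    and \<omega>: "\<omega> = T ` \<omega>\<^sub>0" "P = (`) T ` P\<^sub>0"
    using patch unfolding edge_patch_def by blast
  obtain c u w where c: "T = chart c u w" "axes u w" "norm u = 1" "norm w = 1"
    using rigid_motion_chart[OF T] .
  have loc: "weak_pressure u' w' \<omega> P q \<beta>" if "tiling \<omega> P" "axes u' w'" for u' w'
    using that q \<beta> below L2_norm_pos[OF that(1) q] by unfold_locales auto
  have inv: "a \<le> \<sigma> * b" if "inverse \<sigma> * a \<le> b" for a b :: real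
    using that \<sigma> by (simp add: field_simps)
  from p consider "patch_d \<sigma> \<omega>\<^sub>0 P\<^sub>0" | "patch_e \<sigma> \<omega>\<^sub>0 P\<^sub>0" | "patch_f \<sigma> \<omega>\<^sub>0 P\<^sub>0" by blast
  then show ?thesis
  proof cases
    case 1
    then obtain H h L where hL: "0 < h" "h \<le> H" "inverse \<sigma> * H \<le> L" "L \<le> \<sigma> * H"
      and \<omega>0: "\<omega>\<^sub>0 = {-H..H} \<times> {-h..h} \<union> {-H..H} \<times> {h..h+L}"
      and P0: "P\<^sub>0 = {{-H..0} \<times> {-h..h}, {0..H} \<times> {-h..h}, {-H..0} \<times> {h..h+L}, {0..H} \<times> {h..h+L}}"
      unfolding patch_d_def by blast
    have h: "0 < h" "h \<le> H" "H \<le> \<sigma> * L" "L \<le> \<sigma> * H" using hL inv by auto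
    have "0 < \<sigma> * L" using h by simp
    then have L: "0 < L" using \<sigma> by (simp add: zero_less_mult_iff)
    have "tiling (chart c u w ` \<Union>P\<^sub>0) ((`) (chart c u w) ` P\<^sub>0)"
    proof (rule tiling_chart[OF c(2)])
      show "\<forall>K\<in>P\<^sub>0. rectangle K"
        using h L by (simp add: P0 rectangleI)
      show "pairwise separated P\<^sub>0"
        unfolding P0
        by (intro pairwise_separated_insert pairwise_empty; elim insertE emptyE;
            simp add: separated_intervals less_imp_le[OF h(1)])
    qed (simp add: P0)
    moreover have "\<Union>P\<^sub>0 = \<omega>\<^sub>0"
    proof (intro equalityI subrelI)
      show "(x, y) \<in> \<omega>\<^sub>0" if "(x, y) \<in> \<Union>P\<^sub>0" for x y
        using that h unfolding P0 \<omega>0 by (elim UnionE insertE emptyE) simp_all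
      show "(x, y) \<in> \<Union>P\<^sub>0" if "(x, y) \<in> \<omega>\<^sub>0" for x y
        using that h(1) unfolding P0 \<omega>0 by (cases "x \<le> 0"; cases "y \<le> 0"; cases "y \<le> h"; force)
    qed
    ultimately have t: "tiling \<omega> P" by (simp add: \<omega> c(1))
    interpret weak_pressure c u w \<omega> P q \<beta> "2 * \<sigma>" by (rule loc[OF t c(2)])
    have P: "P = {cell (- H) 0 (- h) h, cell 0 H (- h) h, cell (- H) 0 h (h + L), cell 0 H h (h + L)}"
      by (simp add: \<omega>(2) P0 c(1) cell_def)
    show ?thesis
      by (rule conclude_norm_bound[OF norm_bound_d[OF \<sigma> refl c(3,4) h P] _ \<sigma> refl])
        (unfold P, intro card_insert_le_m1; simp)
  next
    case 2
    then obtain H h L where hL: "0 < h" "h \<le> H" "inverse \<sigma> * H \<le> L" "L \<le> \<sigma> * H"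
      and \<omega>0: "\<omega>\<^sub>0 = {-H..H} \<times> {-h..h} \<union> {-H..H} \<times> {h..h+L}"
      and P0: "P\<^sub>0 = {{-H..0} \<times> {-h..0}, {0..H} \<times> {-h..0}, {-H..0} \<times> {0..h}, {0..H} \<times> {0..h},
              {-H..0} \<times> {h..h+L}, {0..H} \<times> {h..h+L}}"
      unfolding patch_e_def by blast
    have h: "0 < h" "h \<le> H" "H \<le> \<sigma> * L" "L \<le> \<sigma> * H" using hL inv by auto
    have "0 < \<sigma> * L" using h by simp
    then have L: "0 < L" using \<sigma> by (simp add: zero_less_mult_iff)
    have "tiling (chart c u w ` \<Union>P\<^sub>0) ((`) (chart c u w) ` P\<^sub>0)"
    proof (rule tiling_chart[OF c(2)])
      show "\<forall>K\<in>P\<^sub>0. rectangle K"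
        using h L by (simp add: P0 rectangleI)
      show "pairwise separated P\<^sub>0"
        unfolding P0
        by (intro pairwise_separated_insert pairwise_empty; elim insertE emptyE;
            simp add: separated_intervals less_imp_le[OF h(1)])
    qed (simp add: P0)
    moreover have "\<Union>P\<^sub>0 = \<omega>\<^sub>0"
    proof (intro equalityI subrelI)
      show "(x, y) \<in> \<omega>\<^sub>0" if "(x, y) \<in> \<Union>P\<^sub>0" for x y
        using that h unfolding P0 \<omega>0 by (elim UnionE insertE emptyE) simp_all
      show "(x, y) \<in> \<Union>P\<^sub>0" if "(x, y) \<in> \<omega>\<^sub>0" for x y
        using that h(1) unfolding P0 \<omega>0 by (cases "x \<le> 0"; cases "y \<le> 0"; cases "y \<le> h"; force)
    qed
    ultimately have t: "tiling \<omega> P" by (simp add: \<omega> c(1))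
    interpret weak_pressure c u w \<omega> P q \<beta> "2 * \<sigma>" by (rule loc[OF t c(2)])
    have P: "P = {cell (- H) 0 (- h) 0, cell 0 H (- h) 0, cell (- H) 0 0 h, cell 0 H 0 h,
                 cell (- H) 0 h (h + L), cell 0 H h (h + L)}"
      by (simp add: \<omega>(2) P0 c(1) cell_def)
    show ?thesis
      by (rule conclude_norm_bound[OF norm_bound_e[OF \<sigma> refl c(3,4) h P] _ \<sigma> refl])
        (unfold P, intro card_insert_le_m1; simp)
  next
    case 3
    then obtain A\<^sub>1 A\<^sub>2 t where A: "0 < A\<^sub>1" "0 < A\<^sub>2" "inverse \<sigma> \<le> A\<^sub>1 / A\<^sub>2" "A\<^sub>1 / A\<^sub>2 \<le> \<sigma>" and t: "0 < t" "t \<le> 1 / 2"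
      and \<omega>0: "\<omega>\<^sub>0 = (\<lambda>(x, y). (A\<^sub>1 * x, A\<^sub>2 * y)) ` ({0..1} \<times> {0..1} - {0..<t} \<times> {0..<t})"
      and P0: "P\<^sub>0 = (`) (\<lambda>(x, y). (A\<^sub>1 * x, A\<^sub>2 * y)) `
            {{t..(1 + t) / 2} \<times> {0..t}, {(1 + t) / 2..1} \<times> {0..t},
             {0..t} \<times> {t..(1 + t) / 2}, {0..t} \<times> {(1 + t) / 2..1},
             {t..(1 + t) / 2} \<times> {t..(1 + t) / 2}, {(1 + t) / 2..1} \<times> {t..(1 + t) / 2},
             {t..(1 + t) / 2} \<times> {(1 + t) / 2..1}, {(1 + t) / 2..1} \<times> {(1 + t) / 2..1}}"
      unfolding patch_f_def Let_def by blast
    define m where "m = (1 + t) / 2"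
    define R where "R = {{t..m} \<times> {0..t}, {m..1} \<times> {0..t}, {0..t} \<times> {t..m}, {0..t} \<times> {m..1},
             {t..m} \<times> {t..m}, {m..1} \<times> {t..m}, {t..m} \<times> {m..1}, {m..1} \<times> {m..1}}"
    have m: "t < m" "m < 1" using t by (auto simp: m_def)
    define u' where "u' = A\<^sub>1 *\<^sub>R u"
    define w' where "w' = A\<^sub>2 *\<^sub>R w"
    have ax': "axes u' w'" unfolding u'_def w'_def using A c(2) by (intro axes_scale) auto
    have n: "norm u' \<le> \<sigma> * norm w'" "norm w' \<le> \<sigma> * norm u'"
      using A c(3,4) \<sigma> by (auto simp: u'_def w'_def field_simps)
    have S: "T ` (\<lambda>(x, y). (A\<^sub>1 * x, A\<^sub>2 * y)) ` X = chart c u' w' ` X" for X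
      unfolding image_image c(1) by (intro image_cong) (auto simp: chart_def u'_def w'_def mult.commute)
    have "tiling (chart c u' w' ` \<Union>R) ((`) (chart c u' w') ` R)"
    proof (rule tiling_chart[OF ax'])
      show "\<forall>K\<in>R. rectangle K"
        using m t by (simp add: R_def rectangleI)
      show "pairwise separated R"
        unfolding R_def
        by (intro pairwise_separated_insert pairwise_empty; elim insertE emptyE;
            simp add: separated_intervals less_imp_le[OF m(1)])
    qed (simp add: R_def)
    moreover have "\<omega> = chart c u' w' ` \<Union>R"
    proof -
      have "\<Union>R = {0..1} \<times> {0..1} - {0..<t} \<times> {0..<t}"
      proof (intro equalityI subrelI)
        show "(x, y) \<in> {0..1} \<times> {0..1} - {0..<t} \<times> {0..<t}" if "(x, y) \<in> \<Union>R" for x y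
          using that m t unfolding R_def by (elim UnionE insertE emptyE) auto
        show "(x, y) \<in> \<Union>R" if "(x, y) \<in> {0..1} \<times> {0..1} - {0..<t} \<times> {0..<t}" for x y
          using that m t unfolding R_def
          by (cases "x < t"; cases "x \<le> m"; cases "y < t"; cases "y \<le> m") simp_all
      qed
      then show ?thesis by (simp add: \<omega>(1) \<omega>0 S)
    qed
    moreover have PR: "P = (`) (chart c u' w') ` R"
      unfolding \<omega>(2) P0 m_def[symmetric] R_def[symmetric]
      by (subst image_image) (simp only: S)
    ultimately have til: "tiling \<omega> P" by simp
    interpret weak_pressure c u' w' \<omega> P q \<beta> "2 * \<sigma>" by (rule loc[OF til ax'])
    have P: "P = {cell t m 0 t, cell m 1 0 t, cell 0 t t m, cell 0 t m 1,
                 cell t m t m, cell m 1 t m, cell t m m 1, cell m 1 m 1}"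
      by (simp add: PR R_def cell_def)
    show ?thesis
      by (rule conclude_norm_bound[OF norm_bound_f[OF \<sigma> refl n t m_def P] _ \<sigma> refl])
        (unfold P, intro card_insert_le_m1; simp)
  qed
qed

theorem theorem1:
  fixes \<sigma> :: real
  assumes "\<sigma> \<ge> 1"
  shows "\<exists>\<beta>::real. \<beta> > 0 \<and> (\<forall>\<omega> P. edge_patch \<sigma> \<omega> P \<longrightarrow> inf_sup \<omega> P \<ge> ereal \<beta>)"
proof -
  define N where "N = 8 * 4 * 30 * 144\<^sup>2 * \<sigma> * (32 * \<sigma>\<^sup>2 + 1)"
  define \<beta> where "\<beta> = 1 / (2 * N)"
  have "N \<ge> 1 * 1"
    unfolding N_def using assms by (intro mult_mono) auto
  then have N: "N \<ge> 1" by simp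
  then have \<beta>: "\<beta> > 0" by (simp add: \<beta>_def)
  \<comment> \<open>the only property of \<open>\<beta>\<close>, besides its sign, on which the argument depends\<close>
  have "N * \<beta>\<^sup>2 < 1"
    using N by (simp add: \<beta>_def power2_eq_square field_simps)
  then have no: "\<not> 1 \<le> 8 * 4 * 30 * 144\<^sup>2 * \<sigma> * (32 * \<sigma>\<^sup>2 + 1) * \<beta>\<^sup>2"
    unfolding N_def by simp
  have "inf_sup \<omega> P \<ge> ereal \<beta>" if patch: "edge_patch \<sigma> \<omega> P" for \<omega> P
    unfolding inf_sup_def
  proof (rule INF_greatest)
    fix q assume "q \<in> {q \<in> pressure_space \<omega> P. \<exists>x\<in>\<omega>. q x \<noteq> 0}"
    then obtain x where q: "q \<in> pressure_space \<omega> P" "x \<in> \<omega>" "q x \<noteq> 0" by auto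
    have "\<not> inf_sup_below \<beta> \<omega> P q"
      using weak_pressure_bound[OF assms patch q \<beta>] no by blast
    then obtain v where v: "v \<in> {v \<in> velocity_space \<omega> P. \<exists>x\<in>\<omega>. v x \<noteq> 0}"
      and "\<beta> < (LINT x:\<omega>|lebesgue. q x * divergence v x) / (H1_seminorm_on \<omega> v * L2_norm_on \<omega> q)"
      unfolding inf_sup_below_def by (auto simp: not_le)
    then have "ereal \<beta> \<le> ereal ((LINT x:\<omega>|lebesgue. q x * divergence v x) / (H1_seminorm_on \<omega> v * L2_norm_on \<omega> q))"
      by simp
    then show "ereal \<beta> \<le> (SUP v \<in> {v \<in> velocity_space \<omega> P. \<exists>x\<in>\<omega>. v x \<noteq> 0}.
        ereal ((LINT x:\<omega>|lebesgue. q x * divergence v x) / (H1_seminorm_on \<omega> v * L2_norm_on \<omega> q)))"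
      by (rule SUP_upper2[OF v])
  qed
  with \<beta> show ?thesis by blast
qed

end
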